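(* Let $v_2$ denote the second eigenvector of $\mathcal{L}_{G(n,p)}$, normalized so that $\|v_2\|_2=1$. For every fixed $p \in (0,1)$ and fixed $\eta \in (0,1/2)$ there exists a constant $C = C(p,\eta)$ such that $$\mathbb{P}\left[ \frac{1}{n}\, \#\left\{ i \in [n] : |v_2(i)| \geq \frac{1}{\sqrt{n}\,(\log n)^C} \right\} \geq \frac12 - \eta \right] \to 1 \quad \text{as } n\to\infty.$$
   Context: $G(n,p)$ is the Erdős–Rényi random graph on vertex set $[n]=\{1,\dots,n\}$ in which each pair of vertices is joined by an edge independently with probability $p$. For a finite simple graph $G$ with $n$ vertices, adjacency matrix $A$ and diagonal degree matrix $D$, the normalized Laplacian is $\mathcal{L}_G = D^{-1/2}(D-A)D^{-1/2}$, where, by convention, the diagonal entry of $D^{-1/2}$ at a vertex of degree $0$ is $0$. Its eigenvalues are listed in increasing order $0=\lambda_1(\mathcal{L}_G) \le \lambda_2(\mathcal{L}_G) \le \dots \le \lambda_n(\mathcal{L}_G)$. The second eigenvector $v_2$ is an eigenvector of $\mathcal{L}_G$ with eigenvalue $\lambda_2(\mathcal{L}_G)$; $v_2(i)$ is its $i$-th coordinate. *)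

theory Defs
  imports
    "HOL-Probability.Product_PMF"
    "HOL-Analysis.L2_Norm"
    "HOL-Computational_Algebra.Polynomial"
    "Jordan_Normal_Form.Matrix"
    "Jordan_Normal_Form.Char_Poly"
begin

text \<open>
  A simple graph on \<open>n\<close> vertices is represented by its set of edges, a subset of \<open>vertex_pairs n\<close>.
  The vertices are \<open>0, \<dots>, n - 1\<close> rather than \<open>1, \<dots>, n\<close>, in line with the indexing of matrices.
\<close>

definition vertex_pairs :: "nat \<Rightarrow> nat set set" where
  "vertex_pairs n = {e. e \<subseteq> {..<n} \<and> card e = 2}"

definition random_graph :: "nat \<Rightarrow> real \<Rightarrow> nat set set pmf" where
  "random_graph n p =
     map_pmf (\<lambda>f. {e \<in> vertex_pairs n. f e})
       (Pi_pmf (vertex_pairs n) False (\<lambda>_. bernoulli_pmf p))"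

definition degree_of :: "nat \<Rightarrow> nat set set \<Rightarrow> nat \<Rightarrow> nat" where
  "degree_of n E i = card {j \<in> {..<n}. {i, j} \<in> E}"

definition adjacency_mat :: "nat \<Rightarrow> nat set set \<Rightarrow> real mat" where
  "adjacency_mat n E = mat n n (\<lambda>(i, j). if {i, j} \<in> E then 1 else 0)"

definition degree_mat :: "nat \<Rightarrow> nat set set \<Rightarrow> real mat" where
  "degree_mat n E = mat_diag n (\<lambda>i. real (degree_of n E i))"

text \<open>
  Since \<open>1 / sqrt 0 = 0\<close> in HOL, the entry at an isolated vertex is \<open>0\<close>.
\<close>

definition inv_sqrt_degree_mat :: "nat \<Rightarrow> nat set set \<Rightarrow> real mat" where
  "inv_sqrt_degree_mat n E = mat_diag n (\<lambda>i. 1 / sqrt (real (degree_of n E i)))"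

definition normalized_laplacian :: "nat \<Rightarrow> nat set set \<Rightarrow> real mat" where
  "normalized_laplacian n E =
     inv_sqrt_degree_mat n E * (degree_mat n E - adjacency_mat n E) * inv_sqrt_degree_mat n E"

text \<open>
  The real eigenvalues in increasing order, repeated according to algebraic multiplicity. For a real
  symmetric matrix of dimension \<open>n\<close> the list has length \<open>n\<close>.
\<close>

definition sorted_eigenvalues :: "real mat \<Rightarrow> real list" where
  "sorted_eigenvalues M = sorted_list_of_multiset (proots (char_poly M))"

text \<open>
  List positions start at \<open>0\<close>, so the second smallest eigenvalue is at position \<open>1\<close>; it is meaningful
  for matrices of dimension at least \<open>2\<close>.
\<close>

definition second_eigenvalue :: "real mat \<Rightarrow> real" where
  "second_eigenvalue M = sorted_eigenvalues M ! 1"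

definition unit_second_eigenvector :: "real mat \<Rightarrow> real vec \<Rightarrow> bool" where
  "unit_second_eigenvector M v \<longleftrightarrow>
     eigenvector M v (second_eigenvalue M) \<and> L2_set (vec_index v) {..<dim_vec v} = 1"

end

theory Submission
  imports Defs "HOL-Probability.Probability" "HOL-Real_Asymp.Real_Asymp"
begin

text \<open>
  The bound holds for every unit eigenvector \<open>v\<close>, with threshold \<open>\<epsilon> / \<surd>n\<close> for a constant \<open>\<epsilon>\<close>.
  With \<open>D\<close> the degree matrix, \<open>y = D\<^sup>-\<^sup>1\<^sup>/\<^sup>2 v\<close> satisfies \<open>A y = \<mu> D y\<close>. Unless \<open>y\<close> is constant, it is
  orthogonal to the degrees, so with \<open>W = A - p J\<close> (whose norm is \<open>O(\<surd>n)\<close>) one gets \<open>\<mu> = O(1 / \<surd>n)\<close> and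
  \<open>W y + t 1 = \<mu> D y\<close> with a bounded \<open>t\<close>. On the set where \<open>y\<close> is below \<open>\<tau> / \<surd>n\<close> the right side is
  \<open>O(\<tau>)\<close>. Rounding \<open>y\<close> towards zero to the grid of mesh \<open>\<tau> / \<surd>n\<close> gives a grid vector supported on the
  complement \<open>T\<close> of that set whose image under the independent rows outside \<open>T\<close> is nearly constant.

  For \<open>\<tau> = \<rho>\<close> constant and \<open>|T| \<le> \<delta> n\<close> this is excluded by a small ball probability bounded away
  from 1 per row and the small number of sparse grid vectors. Otherwise \<open>y\<close> is spread, each row has small
  ball probability \<open>O(\<epsilon>)\<close> at scale \<open>\<tau> = \<epsilon>\<close>, and if \<open>|T| \<le> (1 / 2 - \<eta>) n\<close> the resulting
  \<open>(C \<epsilon>)\<close> to the power \<open>(1 / 2 + \<eta>) n\<close> beats the at most \<open>(C / \<epsilon>)\<close> to the power \<open>(1 / 2 - \<eta>) n\<close>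
  grid vectors once \<open>\<epsilon>\<close> is a small enough constant.
\<close>

section \<open>Counting grid vectors\<close>

text \<open>\<open>extensional\<close> fixes the values outside \<open>{..<n}\<close>, so that each
  integer vector is counted once and the set is finite. The bounds are real so that they can be
  fractions of \<open>n\<close>.\<close>

definition grid :: "nat \<Rightarrow> real \<Rightarrow> real \<Rightarrow> (nat \<Rightarrow> int) set" where
  "grid n m r = {k \<in> extensional {..<n}.
     real_of_int (\<Sum>i<n. \<bar>k i\<bar>) \<le> m \<and> real (card {i \<in> {..<n}. k i \<noteq> 0}) \<le> r}"

text \<open>A geometric series: the ratio \<open>b = 1 / (1 + a)\<close> satisfies
  \<open>b * a = 1 - b\<close>, so each of the two tails sums to \<open>s / a\<close>. The factor
  \<open>1 - b ^ N\<close> records the exact partial sum, which is what the induction needs.\<close>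

lemma sum_geometric_int_le:
  fixes a s :: real
  assumes "0 < a" "0 \<le> s"
  shows "(\<Sum>u=-int N..int N. (if u = 0 then 1 else s) * (1 / (1 + a)) ^ nat \<bar>u\<bar>)
           \<le> 1 + 2 * s / a * (1 - (1 / (1 + a)) ^ N)"
proof (induction N)
  case (Suc N)
  let ?b = "1 / (1 + a)"
  let ?w = "\<lambda>u::int. (if u = 0 then 1 else s) * ?b ^ nat \<bar>u\<bar>"
  have "{-int (Suc N)..int (Suc N)} = insert (-int (Suc N)) (insert (int (Suc N)) {-int N..int N})"
    by auto
  hence "sum ?w {-int (Suc N)..int (Suc N)} = sum ?w {-int N..int N} + 2 * s * ?b ^ Suc N"
    by (simp add: nat_add_distrib)
  also have "\<dots> \<le> 1 + 2 * s / a * (1 - ?b ^ N) + 2 * s * ?b ^ Suc N"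
    using Suc by simp
  also have "\<dots> = 1 + 2 * s / a * (1 - ?b ^ Suc N)"
  proof -
    have b: "?b * a = 1 - ?b" using assms by (simp add: field_simps)
    have "2 * s * ?b ^ Suc N = 2 * s / a * (?b ^ N * (?b * a))" using assms by simp
    also have "\<dots> = 2 * s / a * (?b ^ N - ?b ^ Suc N)" unfolding b by (simp add: algebra_simps)
    finally show ?thesis by (simp add: algebra_simps)
  qed
  finally show ?case .
qed simp

text \<open>A generating function count: each point gets weight \<open>(1 + a)\<close> to the minus its
  \<open>\<ell>\<^sub>1\<close>-norm, times \<open>s\<close> for every point of its support.\<close>

lemma grid_card:
  fixes a s m r :: real
  assumes "0 < a" "0 < s" "s \<le> 1"
  shows "finite (grid n m r)"
    and "real (card (grid n m r)) \<le> (1 + a) powr m * (1 / s) powr r * (1 + 2 * s / a) ^ n"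
proof -
  define N where "N = nat \<lfloor>m\<rfloor>"
  define b where "b = 1 / (1 + a)"
  define w :: "int \<Rightarrow> real" where "w u = (if u = 0 then 1 else s) * b ^ nat \<bar>u\<bar>" for u
  have b: "0 < b" "b < 1" using assms by (auto simp: b_def)
  have w0: "0 \<le> w u" for u using assms b by (auto simp: w_def)
  have sub: "grid n m r \<subseteq> PiE {..<n} (\<lambda>_. {-int N..int N})"
  proof
    fix k assume k: "k \<in> grid n m r"
    have "k i \<in> {-int N..int N}" if i: "i < n" for i
    proof -
      have "\<bar>k i\<bar> \<le> (\<Sum>i<n. \<bar>k i\<bar>)"
        using i by (intro member_le_sum) auto
      also have "\<dots> \<le> int N"
        using k sum_nonneg[of "{..<n}" "\<lambda>i. \<bar>k i\<bar>"]
        by (simp add: grid_def N_def le_floor_iff flip: of_int_abs of_int_sum)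
      finally show ?thesis by auto
    qed
    thus "k \<in> PiE {..<n} (\<lambda>_. {-int N..int N})" using k by (auto simp: grid_def PiE_iff)
  qed
  have finP: "finite (PiE {..<n} (\<lambda>_. {-int N..int N}))"
    by (intro finite_PiE) auto
  show fin: "finite (grid n m r)" using sub finP by (rule finite_subset)
  \<comment> \<open>Rankin's trick: every grid point has at least this weight, so the number of
    points is at most the total weight divided by it.\<close>
  have wk: "b powr m * s powr r \<le> (\<Prod>i<n. w (k i))" if k: "k \<in> grid n m r" for k
  proof -
    have "(\<Prod>i<n. w (k i)) = (\<Prod>i<n. if k i \<noteq> 0 then s else 1) * b ^ (\<Sum>i<n. nat \<bar>k i\<bar>)"
      unfolding w_def prod.distrib power_sum
      by (intro arg_cong2[where f = "(*)"] prod.cong) auto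
    also have "(\<Prod>i<n. if k i \<noteq> 0 then s else 1) = s ^ card {i \<in> {..<n}. k i \<noteq> 0}"
      by (simp add: prod.If_cases Int_def)
    also have "b ^ (\<Sum>i<n. nat \<bar>k i\<bar>) = b powr real (\<Sum>i<n. nat \<bar>k i\<bar>)"
      using b by (intro powr_realpow[symmetric])
    also have "s ^ card {i \<in> {..<n}. k i \<noteq> 0} = s powr real (card {i \<in> {..<n}. k i \<noteq> 0})"
      using assms by (simp add: powr_realpow)
    finally have eq: "(\<Prod>i<n. w (k i)) =
      s powr real (card {i \<in> {..<n}. k i \<noteq> 0}) * b powr real (\<Sum>i<n. nat \<bar>k i\<bar>)" .
    have "real (\<Sum>i<n. nat \<bar>k i\<bar>) \<le> m" using k by (simp add: grid_def)
    hence "b powr m \<le> b powr real (\<Sum>i<n. nat \<bar>k i\<bar>)"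
      using b by (intro powr_mono') auto
    moreover have "s powr r \<le> s powr real (card {i \<in> {..<n}. k i \<noteq> 0})"
      using k assms by (intro powr_mono') (auto simp: grid_def)
    ultimately show ?thesis unfolding eq
      by (metis mult.commute mult_mono powr_ge_zero)
  qed
  have "real (card (grid n m r)) * (b powr m * s powr r) = (\<Sum>k\<in>grid n m r. b powr m * s powr r)"
    by simp
  also have "\<dots> \<le> (\<Sum>k\<in>grid n m r. \<Prod>i<n. w (k i))" by (intro sum_mono wk)
  \<comment> \<open>Over the full box the sum of products becomes a product of one-dimensional
    sums.\<close>
  also have "\<dots> \<le> (\<Sum>k\<in>PiE {..<n} (\<lambda>_. {-int N..int N}). \<Prod>i<n. w (k i))"
    by (intro sum_mono2 finP sub prod_nonneg) (use w0 in auto)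
  also have "\<dots> = (\<Prod>i<n. \<Sum>u=-int N..int N. w u)"
    by (subst prod_sum_PiE) auto
  also have "\<dots> \<le> (1 + 2 * s / a) ^ n"
  proof -
    have "(\<Sum>u=-int N..int N. w u) \<le> 1 + 2 * s / a * (1 - b ^ N)"
      using sum_geometric_int_le[of a s N] assms by (simp add: w_def b_def)
    also have "\<dots> \<le> 1 + 2 * s / a * 1"
      using assms b by (intro add_left_mono mult_left_mono) auto
    finally show ?thesis using w0 by (simp add: power_mono sum_nonneg)
  qed
  finally have "real (card (grid n m r)) * (b powr m * s powr r) \<le> (1 + 2 * s / a) ^ n" .
  hence "real (card (grid n m r)) * (b powr m * s powr r) * ((1 + a) powr m * (1 / s) powr r)
      \<le> (1 + 2 * s / a) ^ n * ((1 + a) powr m * (1 / s) powr r)"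
    by (intro mult_right_mono) auto
  moreover have "b powr m * s powr r * ((1 + a) powr m * (1 / s) powr r) = 1"
    using assms by (simp add: b_def powr_divide)
  ultimately show "real (card (grid n m r)) \<le> (1 + a) powr m * (1 / s) powr r * (1 + 2 * s / a) ^ n"
    by (simp only: mult.assoc mult_1_right) (simp only: mult.commute mult.left_commute)
qed

section \<open>Small ball probabilities for sums of coin flips\<close>

abbreviation coin_flips :: "'e set \<Rightarrow> real \<Rightarrow> ('e \<Rightarrow> bool) pmf" where
  "coin_flips V p \<equiv> Pi_pmf V False (\<lambda>_. bernoulli_pmf p)"

lemma finite_set_coin_flips: "finite V \<Longrightarrow> finite (set_pmf (coin_flips V p))"
  by (rule finite_subset[OF set_Pi_pmf_subset']) (auto intro!: finite_PiE_dflt)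

lemma integrable_coin_flips:
  fixes f :: "('e \<Rightarrow> bool) \<Rightarrow> 'b::{banach, second_countable_topology}"
  shows "finite V \<Longrightarrow> integrable (measure_pmf (coin_flips V p)) f"
  by (intro integrable_measure_pmf_finite finite_set_coin_flips)

lemma expectation_bernoulli:
  fixes f :: "bool \<Rightarrow> 'b::{banach, second_countable_topology}"
  assumes "0 \<le> p" "p \<le> 1"
  shows "measure_pmf.expectation (bernoulli_pmf p) f = p *\<^sub>R f True + (1 - p) *\<^sub>R f False"
  using assms by (subst integral_measure_pmf[of UNIV]) (auto simp: UNIV_bool)

text \<open>Independence of the coordinates. The codomain is a general normed field because complex
  values are needed for characteristic functions and real ones for the means in Hoeffding's
  inequality.\<close>

lemma expectation_coin_flips_prod:
  fixes f :: "'e \<Rightarrow> bool \<Rightarrow> 'b::{real_normed_field, banach, second_countable_topology}"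
  assumes V: "finite V" "A \<subseteq> V" and p: "0 \<le> p" "p \<le> 1"
  shows "measure_pmf.expectation (coin_flips V p) (\<lambda>\<omega>. \<Prod>e\<in>A. f e (\<omega> e)) =
    (\<Prod>e\<in>A. p *\<^sub>R f e True + (1 - p) *\<^sub>R f e False)"
proof -
  let ?Q = "coin_flips V p"
  have ind: "prob_space.indep_vars ?Q (\<lambda>_. count_space UNIV) (\<lambda>e \<omega>. \<omega> e) A"
    using prob_space.indep_vars_subset[OF measure_pmf.prob_space_axioms indep_vars_Pi_pmf[OF V(1)] V(2)] .
  have "prob_space.indep_vars ?Q (\<lambda>_. borel) (\<lambda>e \<omega>. f e (\<omega> e)) A"
    by (rule prob_space.indep_vars_compose2[OF measure_pmf.prob_space_axioms ind]) auto
  hence "measure_pmf.expectation ?Q (\<lambda>\<omega>. \<Prod>e\<in>A. f e (\<omega> e))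
      = (\<Prod>e\<in>A. measure_pmf.expectation ?Q (\<lambda>\<omega>. f e (\<omega> e)))"
    using V by (intro prob_space.indep_vars_lebesgue_integral[OF measure_pmf.prob_space_axioms] integrable_coin_flips)
      (auto intro: finite_subset)
  also have "\<dots> = (\<Prod>e\<in>A. p *\<^sub>R f e True + (1 - p) *\<^sub>R f e False)"
  proof (rule prod.cong)
    fix e assume e: "e \<in> A"
    have "measure_pmf.expectation ?Q (\<lambda>\<omega>. f e (\<omega> e))
        = measure_pmf.expectation (map_pmf (\<lambda>\<omega>. \<omega> e) ?Q) (f e)" by simp
    also have "map_pmf (\<lambda>\<omega>. \<omega> e) ?Q = bernoulli_pmf p"
      using e V by (subst Pi_pmf_component) auto
    finally show "measure_pmf.expectation ?Q (\<lambda>\<omega>. f e (\<omega> e))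
      = p *\<^sub>R f e True + (1 - p) *\<^sub>R f e False"
      using p by (simp add: expectation_bernoulli)
  qed simp
  finally show ?thesis .
qed

text \<open>Functions of disjoint blocks of coins are independent; that \<open>F i\<close> depends
  on the block \<open>K i\<close> only is expressed by invariance under restriction. The blocks will
  be the edges from one vertex outside a set to the vertices of that set.\<close>

lemma expectation_coin_flips_blocks:
  fixes F :: "'i \<Rightarrow> ('e \<Rightarrow> bool) \<Rightarrow> real"
  assumes V: "finite V" and I: "finite I" and K: "\<And>i. i \<in> I \<Longrightarrow> K i \<subseteq> V"
    and disj: "disjoint_family_on K I"
    and F: "\<And>i \<omega>. i \<in> I \<Longrightarrow> F i (restrict \<omega> (K i)) = F i \<omega>"
  shows "measure_pmf.expectation (coin_flips V p) (\<lambda>\<omega>. \<Prod>i\<in>I. F i \<omega>) =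
    (\<Prod>i\<in>I. measure_pmf.expectation (coin_flips V p) (F i))"
proof -
  let ?Q = "coin_flips V p"
  have "prob_space.indep_vars ?Q (\<lambda>i. PiM (K i) (\<lambda>_. count_space UNIV))
      (\<lambda>i \<omega>. restrict (\<lambda>e. \<omega> e) (K i)) I"
    by (rule prob_space.indep_vars_restrict[OF measure_pmf.prob_space_axioms indep_vars_Pi_pmf[OF V] K disj])
  hence "prob_space.indep_vars ?Q (\<lambda>_. borel) (\<lambda>i \<omega>. F i (restrict (\<lambda>e. \<omega> e) (K i))) I"
  proof (rule prob_space.indep_vars_compose2[OF measure_pmf.prob_space_axioms])
    fix i assume "i \<in> I"
    hence "finite (K i)" using K V finite_subset by blast
    thus "F i \<in> PiM (K i) (\<lambda>_. count_space UNIV) \<rightarrow>\<^sub>M borel"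
      by (subst count_space_PiM_finite) auto
  qed
  hence "prob_space.indep_vars ?Q (\<lambda>_. borel) F I"
    by (rule prob_space.indep_vars_cong[OF measure_pmf.prob_space_axioms, THEN iffD1, rotated -1]) (auto simp: F)
  thus ?thesis
    using V I by (intro prob_space.indep_vars_lebesgue_integral[OF measure_pmf.prob_space_axioms] integrable_coin_flips) auto
qed

section \<open>Characteristic functions and Gaussian averages\<close>

text \<open>From 1 - cos u = 2 sin^2 (u / 2) and sin x >= 7/8 x on (0, 1/2], which holds by the mean
  value theorem as cos >= 7/8 there. The resulting constant 98/256 exceeds 1/4.\<close>

lemma one_minus_cos_ge:
  fixes u :: real
  assumes "\<bar>u\<bar> \<le> 1"
  shows "u\<^sup>2 / 4 \<le> 1 - cos u"
proof -
  have sin_ge: "7 / 8 * x \<le> sin x" if x: "0 < x" "x \<le> 1 / 2" for x :: real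
  proof -
    obtain z where z: "0 < z" "z < x" "sin x - sin 0 = (x - 0) * cos z"
      using MVT2[of 0 x sin cos] x by auto
    have "(sin (z / 2))\<^sup>2 \<le> (z / 2)\<^sup>2"
      using z by (intro power2_le_iff_abs_le[THEN iffD2] order_trans[OF abs_sin_x_le_abs_x]) auto
    also have "\<dots> \<le> (1 / 4)\<^sup>2" using z x by (intro power_mono) auto
    finally have "(sin (z / 2))\<^sup>2 \<le> 1 / 16" by (simp add: power2_eq_square)
    hence "7 / 8 \<le> cos z" using cos_double_sin[of "z / 2"] by simp
    thus ?thesis using z x by (simp add: mult.commute mult_left_mono)
  qed
  have "(7 / 8 * (\<bar>u\<bar> / 2))\<^sup>2 \<le> (sin (\<bar>u\<bar> / 2))\<^sup>2"
  proof (cases "u = 0")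
    case False
    thus ?thesis using assms sin_ge[of "\<bar>u\<bar> / 2"] by (intro power_mono) auto
  qed simp
  hence "49 / 256 * u\<^sup>2 \<le> (sin (\<bar>u\<bar> / 2))\<^sup>2" by (simp add: power2_eq_square field_simps)
  hence "u\<^sup>2 / 4 \<le> 2 * (sin (\<bar>u\<bar> / 2))\<^sup>2" using zero_le_power2[of u] by linarith
  also have "\<dots> = 1 - cos \<bar>u\<bar>" using cos_double_sin[of "\<bar>u\<bar> / 2"] by simp
  finally show ?thesis by (simp add: abs_if split: if_splits)
qed

definition bernoulli_char :: "real \<Rightarrow> real \<Rightarrow> complex" where
  "bernoulli_char p u = p *\<^sub>R iexp u + (1 - p) *\<^sub>R 1"

lemma norm_bernoulli_char_sq:
  "(cmod (bernoulli_char p u))\<^sup>2 = 1 - 2 * p * (1 - p) * (1 - cos u)"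
proof -
  have eq: "bernoulli_char p u = Complex (p * cos u + (1 - p)) (p * sin u)"
    by (simp add: bernoulli_char_def complex_eq_iff Re_exp Im_exp)
  have "(cmod (bernoulli_char p u))\<^sup>2 = (p * cos u + (1 - p))\<^sup>2 + (p * sin u)\<^sup>2"
    unfolding eq cmod_power2 by (simp del: sin_cos_squared_add)
  also have "\<dots> = p\<^sup>2 * ((sin u)\<^sup>2 + (cos u)\<^sup>2) + 2 * p * (1 - p) * cos u + (1 - p)\<^sup>2"
    by (simp add: power2_eq_square algebra_simps del: sin_cos_squared_add sin_cos_squared_add2 sin_cos_squared_add3)
  also have "\<dots> = 1 - 2 * p * (1 - p) * (1 - cos u)"
    by (simp only: sin_cos_squared_add) (simp add: power2_eq_square algebra_simps)
  finally show ?thesis .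
qed

lemma norm_bernoulli_char_le_1:
  assumes "0 \<le> p" "p \<le> 1"
  shows "cmod (bernoulli_char p u) \<le> 1"
proof -
  have "0 \<le> 2 * p * (1 - p) * (1 - cos u)" using assms by (intro mult_nonneg_nonneg) auto
  hence "(cmod (bernoulli_char p u))\<^sup>2 \<le> 1" unfolding norm_bernoulli_char_sq by simp
  thus ?thesis by (simp add: power2_le_iff_abs_le abs_square_le_1)
qed

text \<open>The exact squared modulus combined with 1 + x <= exp x. The range of \<open>u\<close> is
  that of the quadratic lower bound on 1 - cos u.\<close>

lemma norm_bernoulli_char_le_exp:
  assumes "0 \<le> p" "p \<le> 1" "\<bar>u\<bar> \<le> 1"
  shows "cmod (bernoulli_char p u) \<le> exp (- (p * (1 - p) * u\<^sup>2 / 4))"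
proof (rule power2_le_imp_le)
  have "(p * (1 - p)) * (u\<^sup>2 / 4) \<le> (p * (1 - p)) * (1 - cos u)"
    using assms by (intro mult_left_mono one_minus_cos_ge) auto
  hence "(cmod (bernoulli_char p u))\<^sup>2 \<le> 1 + (- (p * (1 - p) * u\<^sup>2 / 2))"
    unfolding norm_bernoulli_char_sq by (simp add: algebra_simps)
  also have "\<dots> \<le> exp (- (p * (1 - p) * u\<^sup>2 / 2))" by (rule exp_ge_add_one_self)
  also have "\<dots> = (exp (- (p * (1 - p) * u\<^sup>2 / 4)))\<^sup>2"
    by (simp add: power2_eq_square flip: exp_add)
  finally show "(cmod (bernoulli_char p u))\<^sup>2 \<le> (exp (- (p * (1 - p) * u\<^sup>2 / 4)))\<^sup>2" .
qed simp

text \<open>The Gaussian kernel is the characteristic function of a standard normal \<open>g\<close>, so averaging it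
  over the coin flips turns into averaging the product characteristic function over \<open>g\<close>.\<close>

lemma expectation_gaussian_le:
  fixes c :: "'e \<Rightarrow> real"
  assumes V: "finite V" "A \<subseteq> V" and p: "0 \<le> p" "p \<le> 1"
  shows "measure_pmf.expectation (coin_flips V p)
           (\<lambda>\<omega>. exp (- (((\<Sum>e\<in>A. c e * of_bool (\<omega> e)) + s)\<^sup>2 / 2)))
         \<le> (LINT g|std_normal_distribution. (\<Prod>e\<in>A. cmod (bernoulli_char p (c e * g))))"
proof -
  interpret N: real_distribution std_normal_distribution by (rule real_dist_normal_dist)
  let ?N = std_normal_distribution
  let ?Q = "coin_flips V p"
  define S where "S = set_pmf ?Q"
  have S: "finite S" unfolding S_def by (rule finite_set_coin_flips[OF V(1)])
  define X where "X \<omega> = (\<Sum>e\<in>A. c e * of_bool (\<omega> e)) + s" for \<omega> :: "'e \<Rightarrow> bool"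
  have expX: "measure_pmf.expectation ?Q f = (\<Sum>\<omega>\<in>S. pmf ?Q \<omega> *\<^sub>R f \<omega>)" for f :: "_ \<Rightarrow> complex"
    using S by (intro integral_measure_pmf) (auto simp: S_def)
  have int: "integrable ?N (\<lambda>g. iexp (t * g))" for t :: real
    by (rule N.integrable_const_bound[of _ 1]) auto
  have fact: "measure_pmf.expectation ?Q (\<lambda>\<omega>. iexp (X \<omega> * g)) =
     iexp (s * g) * (\<Prod>e\<in>A. bernoulli_char p (c e * g))" for g
  proof -
    have fA: "finite A" using V finite_subset by blast
    have "iexp (X \<omega> * g) = iexp (s * g) * (\<Prod>e\<in>A. if \<omega> e then iexp (c e * g) else 1)" for \<omega>
    proof -
      have "iexp (X \<omega> * g) = exp (\<i> * of_real (s * g) + (\<Sum>e\<in>A. \<i> * of_real (c e * of_bool (\<omega> e) * g)))"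
        by (simp add: X_def algebra_simps sum_distrib_left sum_distrib_right)
      also have "\<dots> = iexp (s * g) * (\<Prod>e\<in>A. iexp (c e * of_bool (\<omega> e) * g))"
        using fA by (simp add: exp_add exp_sum)
      also have "(\<Prod>e\<in>A. iexp (c e * of_bool (\<omega> e) * g)) = (\<Prod>e\<in>A. if \<omega> e then iexp (c e * g) else 1)"
        by (intro prod.cong) auto
      finally show ?thesis .
    qed
    hence "measure_pmf.expectation ?Q (\<lambda>\<omega>. iexp (X \<omega> * g)) =
      iexp (s * g) * measure_pmf.expectation ?Q (\<lambda>\<omega>. \<Prod>e\<in>A. if \<omega> e then iexp (c e * g) else 1)"
      by (simp only: integral_mult_right_zero)
    also have "measure_pmf.expectation ?Q (\<lambda>\<omega>. \<Prod>e\<in>A. if \<omega> e then iexp (c e * g) else 1) =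
        (\<Prod>e\<in>A. bernoulli_char p (c e * g))"
      using expectation_coin_flips_prod[OF V p, of "\<lambda>e b. if b then iexp (c e * g) else 1"]
      by (simp add: bernoulli_char_def)
    finally show ?thesis .
  qed
  have "complex_of_real (measure_pmf.expectation ?Q (\<lambda>\<omega>. exp (- ((X \<omega>)\<^sup>2 / 2)))) =
     measure_pmf.expectation ?Q (\<lambda>\<omega>. char ?N (X \<omega>))"
    by (simp add: char_std_normal_distribution flip: integral_complex_of_real)
  also have "\<dots> = (\<Sum>\<omega>\<in>S. pmf ?Q \<omega> *\<^sub>R (CLINT g|?N. iexp (X \<omega> * g)))"
    by (simp add: expX char_def)
  also have "\<dots> = (CLINT g|?N. (\<Sum>\<omega>\<in>S. pmf ?Q \<omega> *\<^sub>R iexp (X \<omega> * g)))"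
    using int by (subst Bochner_Integration.integral_sum) (auto intro!: integrable_scaleR_right)
  also have "\<dots> = (CLINT g|?N. iexp (s * g) * (\<Prod>e\<in>A. bernoulli_char p (c e * g)))"
    unfolding fact[symmetric] expX ..
  finally have eq: "complex_of_real (measure_pmf.expectation ?Q (\<lambda>\<omega>. exp (- ((X \<omega>)\<^sup>2 / 2)))) =
    (CLINT g|?N. iexp (s * g) * (\<Prod>e\<in>A. bernoulli_char p (c e * g)))" .
  have "measure_pmf.expectation ?Q (\<lambda>\<omega>. exp (- ((X \<omega>)\<^sup>2 / 2))) \<le>
     cmod (complex_of_real (measure_pmf.expectation ?Q (\<lambda>\<omega>. exp (- ((X \<omega>)\<^sup>2 / 2)))))"
    by simp
  \<comment> \<open>The shift \<open>s\<close> contributes only a phase of modulus 1, so the bound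
    is uniform in \<open>s\<close>.\<close>
  also have "\<dots> \<le> (LINT g|?N. cmod (iexp (s * g) * (\<Prod>e\<in>A. bernoulli_char p (c e * g))))"
    unfolding eq by (rule integral_norm_bound)
  also have "\<dots> = (LINT g|?N. (\<Prod>e\<in>A. cmod (bernoulli_char p (c e * g))))"
    by (simp add: norm_mult prod_norm)
  finally show ?thesis by (simp add: X_def)
qed

text \<open>Factors indexed by \<open>B\<close> decay like a Gaussian in \<open>g\<close>; all
  others are at most 1.\<close>

lemma prod_bernoulli_char_le:
  fixes c :: "'e \<Rightarrow> real"
  assumes "finite A" "B \<subseteq> A" and p: "0 \<le> p" "p \<le> 1" and B: "\<And>e. e \<in> B \<Longrightarrow> \<bar>c e * g\<bar> \<le> 1"
  shows "(\<Prod>e\<in>A. cmod (bernoulli_char p (c e * g)))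
    \<le> exp (- (p * (1 - p) * (\<Sum>e\<in>B. (c e)\<^sup>2) / 4 * g\<^sup>2))"
proof -
  have fB: "finite B" using assms finite_subset by blast
  have "(\<Prod>e\<in>A. cmod (bernoulli_char p (c e * g))) =
    (\<Prod>e\<in>B. cmod (bernoulli_char p (c e * g))) * (\<Prod>e\<in>A-B. cmod (bernoulli_char p (c e * g)))"
    using assms(1,2) by (simp add: prod.subset_diff mult.commute)
  also have "\<dots> \<le> (\<Prod>e\<in>B. exp (- (p * (1 - p) * (c e * g)\<^sup>2 / 4))) * 1"
    using p B
    by (intro mult_mono prod_mono prod_le_1 conjI norm_bernoulli_char_le_exp norm_bernoulli_char_le_1
        prod_nonneg) auto
  also have "\<dots> = exp (- (p * (1 - p) * (\<Sum>e\<in>B. (c e)\<^sup>2) / 4 * g\<^sup>2))"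
    using fB by (simp add: sum_distrib_left sum_distrib_right power_mult_distrib
        sum_negf sum_divide_distrib mult.assoc flip: exp_sum)
  finally show ?thesis .
qed

text \<open>The normal density times the kernel is a multiple of the normal density of variance
  \<open>1 / (1 + 2 * a)\<close>.\<close>

lemma integral_exp_std_normal:
  fixes a :: real
  assumes "0 \<le> a"
  shows "integrable std_normal_distribution (\<lambda>g. exp (- (a * g\<^sup>2)))"
    and "(LINT g|std_normal_distribution. exp (- (a * g\<^sup>2))) = 1 / sqrt (1 + 2 * a)"
proof -
  interpret N: real_distribution std_normal_distribution by (rule real_dist_normal_dist)
  show "integrable std_normal_distribution (\<lambda>g. exp (- (a * g\<^sup>2)))"
    using assms by (intro N.integrable_const_bound[of _ 1]) auto
  define \<sigma> where "\<sigma> = 1 / sqrt (1 + 2 * a)"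
  have s: "\<sigma> > 0" "\<sigma>\<^sup>2 = 1 / (1 + 2 * a)" using assms by (auto simp: \<sigma>_def power_divide)
  have "std_normal_density g * exp (- (a * g\<^sup>2)) = \<sigma> * normal_density 0 \<sigma> g" for g
  proof -
    have "\<sigma> * normal_density 0 \<sigma> g = (\<sigma> / sqrt (2 * pi * \<sigma>\<^sup>2)) * exp (- (g\<^sup>2) / (2 * \<sigma>\<^sup>2))"
      by (simp add: normal_density_def)
    also have "\<sigma> / sqrt (2 * pi * \<sigma>\<^sup>2) = 1 / sqrt (2 * pi)" using s(1) by (simp add: real_sqrt_mult)
    also have "- (g\<^sup>2) / (2 * \<sigma>\<^sup>2) = - (g\<^sup>2) / 2 + - (a * g\<^sup>2)" unfolding s(2) by (simp add: field_simps)
    finally show ?thesis by (simp add: std_normal_density_def flip: exp_add)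
  qed
  moreover have "(LINT g|std_normal_distribution. exp (- (a * g\<^sup>2)))
      = (LINT g|lborel. std_normal_density g * exp (- (a * g\<^sup>2)))"
    by (subst integral_density) (auto simp: normal_density_nonneg)
  ultimately have "(LINT g|std_normal_distribution. exp (- (a * g\<^sup>2))) = \<sigma>"
    using s integral_normal_density[of \<sigma> 0] by simp
  thus "(LINT g|std_normal_distribution. exp (- (a * g\<^sup>2))) = 1 / sqrt (1 + 2 * a)"
    by (simp add: \<sigma>_def)
qed

text \<open>As long as \<open>\<bar>r * g\<bar> \<le> 1\<close>, all factors in \<open>B\<close> are
  in the Gaussian regime; beyond that the product is at most 1, hence at most
  \<open>r\<^sup>2 * g\<^sup>2\<close>. Integrating gives the two terms, since \<open>g\<close> has
  second moment 1. The bound is small when the coefficients in \<open>B\<close> have a large sum of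
  squares but are individually small.\<close>

lemma gaussian_small_ball_spread:
  fixes c :: "'e \<Rightarrow> real"
  assumes V: "finite V" "A \<subseteq> V" and p: "0 < p" "p < 1" and "B \<subseteq> A"
    and r: "0 < r" "\<And>e. e \<in> B \<Longrightarrow> \<bar>c e\<bar> \<le> r"
    and \<beta>: "0 < \<beta>" "\<beta> \<le> (\<Sum>e\<in>B. (c e)\<^sup>2)"
  shows "measure_pmf.expectation (coin_flips V p)
           (\<lambda>\<omega>. exp (- (((\<Sum>e\<in>A. c e * of_bool (\<omega> e)) + s)\<^sup>2 / 2)))
         \<le> sqrt (2 / (p * (1 - p) * \<beta>)) + r\<^sup>2"
proof -
  interpret N: real_distribution std_normal_distribution by (rule real_dist_normal_dist)
  let ?N = std_normal_distribution
  define a where "a = p * (1 - p) * \<beta> / 4"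
  have a: "0 < a" using p \<beta> by (simp add: a_def)
  have fA: "finite A" using V finite_subset by blast
  let ?P = "\<lambda>g. \<Prod>e\<in>A. cmod (bernoulli_char p (c e * g))"
  have P1: "?P g \<le> 1" and P0: "0 \<le> ?P g" for g
    using p
    by (auto intro!: prod_le_1 norm_bernoulli_char_le_1 prod_nonneg)
  have le: "?P g \<le> exp (- (a * g\<^sup>2)) + r\<^sup>2 * g\<^sup>2" for g
  proof (cases "\<bar>r * g\<bar> \<le> 1")
    case True
    have "\<bar>c e * g\<bar> \<le> 1" if "e \<in> B" for e
    proof -
      have "\<bar>c e * g\<bar> \<le> r * \<bar>g\<bar>" using r(2)[OF that] by (simp add: abs_mult mult_right_mono)
      thus ?thesis using True r by (simp add: abs_mult)
    qed
    hence "?P g \<le> exp (- (p * (1 - p) * (\<Sum>e\<in>B. (c e)\<^sup>2) / 4 * g\<^sup>2))"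
      using fA assms by (intro prod_bernoulli_char_le) auto
    also have "\<dots> \<le> exp (- (a * g\<^sup>2))"
      unfolding a_def using p \<beta> by (simp add: mult_right_mono mult_left_mono)
    finally show ?thesis by (simp add: add_increasing2)
  next
    case False
    hence "1 \<le> \<bar>r * g\<bar>\<^sup>2" by (intro one_le_power) auto
    hence "1 \<le> r\<^sup>2 * g\<^sup>2" by (simp add: power_mult_distrib)
    thus ?thesis using P1[of g] by (simp add: add_increasing)
  qed
  have m2: "integrable ?N (\<lambda>g. g\<^sup>2)" "(LINT g|?N. g\<^sup>2) = 1"
    using std_normal_distribution_even_moments[of 1] by (simp_all add: fact_numeral)
  have bm: "?P \<in> borel_measurable borel"
    unfolding bernoulli_char_def by measurable
  have "measure_pmf.expectation (coin_flips V p)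
           (\<lambda>\<omega>. exp (- (((\<Sum>e\<in>A. c e * of_bool (\<omega> e)) + s)\<^sup>2 / 2))) \<le> (LINT g|?N. ?P g)"
    using V p by (intro expectation_gaussian_le) auto
  also have "\<dots> \<le> (LINT g|?N. exp (- (a * g\<^sup>2)) + r\<^sup>2 * g\<^sup>2)"
  proof (rule integral_mono)
    show "integrable ?N ?P"
      using P0 P1 bm by (intro N.integrable_const_bound[of _ 1]) auto
    show "integrable ?N (\<lambda>g. exp (- (a * g\<^sup>2)) + r\<^sup>2 * g\<^sup>2)"
      using a m2 integral_exp_std_normal(1)[of a] by auto
  qed (rule le)
  also have "\<dots> = 1 / sqrt (1 + 2 * a) + r\<^sup>2"
    using a m2 integral_exp_std_normal[of a] by simp
  also have "1 / sqrt (1 + 2 * a) \<le> 1 / sqrt (2 * a)"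
    using a by (intro divide_left_mono) auto
  also have "1 / sqrt (2 * a) = sqrt (2 / (p * (1 - p) * \<beta>))"
    by (simp add: a_def real_sqrt_divide flip: real_sqrt_mult)
  finally show ?thesis by simp
qed

text \<open>For coefficients that need not be spread the bound is only some \<open>q\<close> below
  1, but uniform in the coins, the coefficients and the shift. The decay for
  \<open>\<bar>g\<bar> \<le> 1\<close> alone pushes the Gaussian average of the majorant
  \<open>h\<close> strictly below 1.\<close>

lemma gaussian_small_ball_const:
  assumes p: "0 < p" "p < 1"
  obtains q :: real where "0 < q" "q < 1"
    "\<And>(V :: 'e set) A c s. \<lbrakk>finite V; A \<subseteq> V; \<And>e. e \<in> A \<Longrightarrow> \<bar>c e\<bar> \<le> 1; 1 / 4 \<le> (\<Sum>e\<in>A. (c e)\<^sup>2)\<rbrakk> \<Longrightarrow>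
      measure_pmf.expectation (coin_flips V p)
           (\<lambda>\<omega>. exp (- (((\<Sum>e\<in>A. c e * of_bool (\<omega> e)) + s)\<^sup>2 / 2))) \<le> q"
proof -
  interpret N: real_distribution std_normal_distribution by (rule real_dist_normal_dist)
  let ?N = std_normal_distribution
  define a where "a = p * (1 - p) / 16"
  have a: "0 < a" using p by (simp add: a_def)
  define h where "h g = (if \<bar>g\<bar> \<le> 1 then exp (- (a * g\<^sup>2)) else 1)" for g :: real
  have h: "0 < h g" "h g \<le> 1" for g using a by (auto simp: h_def)
  have hm [measurable]: "h \<in> borel_measurable borel"
    unfolding h_def by measurable
  have hi: "integrable ?N h"
    using h hm by (intro N.integrable_const_bound[of _ 1]) (auto simp: less_imp_le)
  define q where "q = (LINT g|?N. h g)"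
  have "q < (LINT g|?N. 1)"
    unfolding q_def
  proof (rule N.integral_less_AE[where A = "{0<..<1}"])
    show "emeasure ?N {0<..<1} \<noteq> 0"
    proof
      assume "emeasure ?N {0<..<1} = 0"
      hence "{0<..<1} \<in> null_sets ?N" by (auto simp: null_sets_def)
      hence "AE x in lborel. x \<in> {0<..<1::real} \<longrightarrow> ennreal (std_normal_density x) = 0"
        by (subst (asm) null_sets_density_iff) auto
      moreover have "ennreal (std_normal_density x) \<noteq> 0" for x
        using normal_density_pos[of 1 0 x] by (simp add: ennreal_eq_0_iff not_le)
      ultimately have "AE x in lborel. x \<notin> {0<..<1::real}" by simp
      hence "{0<..<1::real} \<in> null_sets lborel"
        by (simp add: AE_iff_null_sets)
      thus False by (simp add: null_sets_def)
    qed
  qed (use h hi a in \<open>auto simp: h_def\<close>)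
  hence q1: "q < 1" using N.prob_space by simp
  have main: "measure_pmf.expectation (coin_flips V p)
           (\<lambda>\<omega>. exp (- (((\<Sum>e\<in>A. c e * of_bool (\<omega> e)) + s)\<^sup>2 / 2))) \<le> q"
    if V: "finite V" "A \<subseteq> V" and c: "\<And>e. e \<in> A \<Longrightarrow> \<bar>c e\<bar> \<le> 1" "1 / 4 \<le> (\<Sum>e\<in>A. (c e)\<^sup>2)"
    for V A :: "'e set" and c s
  proof -
    let ?P = "\<lambda>g. \<Prod>e\<in>A. cmod (bernoulli_char p (c e * g))"
    have fA: "finite A" using V finite_subset by blast
    have P1: "?P g \<le> 1" and P0: "0 \<le> ?P g" for g
      using p
      by (auto intro!: prod_le_1 norm_bernoulli_char_le_1 prod_nonneg)
    have le: "?P g \<le> h g" for g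
    proof (cases "\<bar>g\<bar> \<le> 1")
      case True
      have "\<bar>c e * g\<bar> \<le> 1" if "e \<in> A" for e
        using mult_mono[OF c(1)[OF that] True] by (simp add: abs_mult)
      hence "?P g \<le> exp (- (p * (1 - p) * (\<Sum>e\<in>A. (c e)\<^sup>2) / 4 * g\<^sup>2))"
        using fA p by (intro prod_bernoulli_char_le) auto
      also have "\<dots> \<le> exp (- (a * g\<^sup>2))"
      proof -
        have "p * (1 - p) * (1 / 4) \<le> p * (1 - p) * (\<Sum>e\<in>A. (c e)\<^sup>2)"
          using p c(2) by (intro mult_left_mono) auto
        hence "a \<le> p * (1 - p) * (\<Sum>e\<in>A. (c e)\<^sup>2) / 4" by (simp add: a_def)
        hence "a * g\<^sup>2 \<le> p * (1 - p) * (\<Sum>e\<in>A. (c e)\<^sup>2) / 4 * g\<^sup>2" by (rule mult_right_mono) simp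
        thus ?thesis by simp
      qed
      finally show ?thesis using True by (simp add: h_def)
    qed (use P1 in \<open>simp add: h_def\<close>)
    have bm: "?P \<in> borel_measurable borel"
      unfolding bernoulli_char_def by measurable
    have "measure_pmf.expectation (coin_flips V p)
           (\<lambda>\<omega>. exp (- (((\<Sum>e\<in>A. c e * of_bool (\<omega> e)) + s)\<^sup>2 / 2))) \<le> (LINT g|?N. ?P g)"
      using V p by (intro expectation_gaussian_le) auto
    also have "\<dots> \<le> (LINT g|?N. h g)"
      using P0 P1 bm hi le by (intro integral_mono N.integrable_const_bound[of ?P 1]) auto
    finally show ?thesis by (simp add: q_def)
  qed
  show ?thesis
  \<comment> \<open>The maximum makes the constant positive, since its logarithm is taken
    later.\<close>
  proof (rule that[of "max q (1 / 2)"])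
    show "max q (1 / 2) < 1" using q1 by simp
    show "measure_pmf.expectation (coin_flips V p)
           (\<lambda>\<omega>. exp (- (((\<Sum>e\<in>A. c e * of_bool (\<omega> e)) + s)\<^sup>2 / 2))) \<le> max q (1 / 2)"
      if "finite V" "A \<subseteq> V" "\<And>e. e \<in> A \<Longrightarrow> \<bar>c e\<bar> \<le> 1" "1 / 4 \<le> (\<Sum>e\<in>A. (c e)\<^sup>2)"
      for V A :: "'e set" and c s
      using main[OF that] by (simp add: max.coboundedI1)
  qed simp
qed

section \<open>The norm of the centred adjacency matrix\<close>

text \<open>\<open>random_graph n p\<close> is the image of the coin flips on
  \<open>vertex_pairs n\<close> under this map, so all probabilities can be computed for independent
  coins.\<close>

definition edges_of :: "nat \<Rightarrow> (nat set \<Rightarrow> bool) \<Rightarrow> nat set set" where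
  "edges_of n \<omega> = {e \<in> vertex_pairs n. \<omega> e}"

lemma finite_vertex_pairs [simp]: "finite (vertex_pairs n)"
  unfolding vertex_pairs_def by (rule finite_subset[of _ "Pow {..<n}"]) auto

lemma pair_in_vertex_pairs_iff: "{i, j} \<in> vertex_pairs n \<longleftrightarrow> i < n \<and> j < n \<and> i \<noteq> j"
  by (auto simp: vertex_pairs_def card_2_iff doubleton_eq_iff)

text \<open>Hoeffding's inequality: the variable \<open>c e * of_bool (\<omega> e)\<close> ranges
  over an interval of length \<open>\<bar>c e\<bar>\<close>. Allowing an upper bound
  \<open>\<beta>\<close> saves computing the sum of squares exactly.\<close>

lemma coin_flips_tail:
  fixes c :: "'e \<Rightarrow> real"
  assumes V: "finite V" "A \<subseteq> V" and p: "0 \<le> p" "p \<le> 1"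
    and \<beta>: "0 < \<beta>" "(\<Sum>e\<in>A. (c e)\<^sup>2) \<le> \<beta>" and s: "0 < s"
  shows "measure_pmf.prob (coin_flips V p) {\<omega>. s \<le> \<bar>\<Sum>e\<in>A. c e * (of_bool (\<omega> e) - p)\<bar>}
           \<le> 2 * exp (- 2 * s\<^sup>2 / \<beta>)"
proof (cases "(\<Sum>e\<in>A. (c e)\<^sup>2) = 0")
  \<comment> \<open>Hoeffding's bound divides by the sum of squares. If that sum vanishes, the event
    is empty because \<open>s\<close> is positive.\<close>
  case True
  have "finite A" using V finite_subset by blast
  hence "\<forall>e\<in>A. c e = 0" using True by (simp add: sum_nonneg_eq_0_iff)
  hence "{\<omega>. s \<le> \<bar>\<Sum>e\<in>A. c e * (of_bool (\<omega> e) - p)\<bar>} = {}" using s by auto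
  thus ?thesis by simp
next
  case False
  let ?Q = "coin_flips V p"
  let ?X = "\<lambda>e \<omega>. c e * of_bool (\<omega> e)"
  have fA: "finite A" using V finite_subset by blast
  have pos: "0 < (\<Sum>e\<in>A. (c e)\<^sup>2)" using False by (simp add: order.not_eq_order_implies_strict sum_nonneg)
  have "prob_space.indep_vars ?Q (\<lambda>_. count_space UNIV) (\<lambda>e \<omega>. \<omega> e) A"
    using prob_space.indep_vars_subset[OF measure_pmf.prob_space_axioms indep_vars_Pi_pmf[OF V(1)] V(2)] .
  hence ind: "prob_space.indep_vars ?Q (\<lambda>_. borel) ?X A"
    by (rule prob_space.indep_vars_compose2[OF measure_pmf.prob_space_axioms]) auto
  interpret H: Hoeffding_ineq ?Q A ?X "\<lambda>e. min 0 (c e)" "\<lambda>e. max 0 (c e)" "p * (\<Sum>e\<in>A. c e)"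
  proof unfold_locales
    show "p * (\<Sum>e\<in>A. c e) \<equiv> \<Sum>e\<in>A. measure_pmf.expectation ?Q (?X e)"
    proof (rule eq_reflection)
      have *: "measure_pmf.expectation ?Q (?X e) = p * c e" if "e \<in> A" for e
        using expectation_coin_flips_prod[of V "{e}" p "\<lambda>e b. c e * of_bool b"] V p that
        by auto
      show "p * (\<Sum>e\<in>A. c e) = (\<Sum>e\<in>A. measure_pmf.expectation ?Q (?X e))"
        unfolding sum_distrib_left by (intro sum.cong refl *[symmetric])
    qed
  qed (use fA ind in auto)
  have w: "(\<Sum>e\<in>A. (max 0 (c e) - min 0 (c e))\<^sup>2) = (\<Sum>e\<in>A. (c e)\<^sup>2)"
    by (intro sum.cong) (auto simp: max_def min_def)
  have "measure_pmf.prob ?Q {\<omega>. s \<le> \<bar>\<Sum>e\<in>A. c e * (of_bool (\<omega> e) - p)\<bar>}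
     = measure_pmf.prob ?Q {\<omega>\<in>space ?Q. \<bar>(\<Sum>e\<in>A. ?X e \<omega>) - p * (\<Sum>e\<in>A. c e)\<bar> \<ge> s}"
    by (simp add: algebra_simps sum_subtractf sum_distrib_left)
  also have "\<dots> \<le> 2 * exp (- 2 * s\<^sup>2 / (\<Sum>e\<in>A. (c e)\<^sup>2))"
    using H.Hoeffding_ineq_abs_ge[of s] s pos unfolding w by simp
  also have "\<dots> \<le> 2 * exp (- 2 * s\<^sup>2 / \<beta>)"
    using pos \<beta> by (auto intro!: divide_left_mono)
  finally show ?thesis .
qed

section \<open>Rounding towards zero\<close>

text \<open>Unlike rounding to the nearest integer, this never increases absolute values and sends
  exactly the numbers of absolute value below 1 to 0. Thus norms do not grow, and the support of a
  rounded vector is the set of its large coordinates.\<close>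

definition toward_zero :: "real \<Rightarrow> int" where
  "toward_zero u = (if 0 \<le> u then \<lfloor>u\<rfloor> else \<lceil>u\<rceil>)"

lemma abs_toward_zero_le: "\<bar>real_of_int (toward_zero u)\<bar> \<le> \<bar>u\<bar>"
proof (cases "0 \<le> u")
  case False
  hence "\<lceil>u\<rceil> \<le> 0" by (simp add: ceiling_le_iff)
  thus ?thesis using False le_of_int_ceiling[of u] by (simp add: toward_zero_def)
qed (simp add: toward_zero_def)

lemma toward_zero_error: "\<bar>u - real_of_int (toward_zero u)\<bar> \<le> 1"
  unfolding toward_zero_def by (auto simp: abs_if) linarith+

lemma toward_zero_eq_0_iff: "toward_zero u = 0 \<longleftrightarrow> \<bar>u\<bar> < 1"
  unfolding toward_zero_def by (auto simp: floor_eq_iff ceiling_eq_iff)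

definition round_to_grid :: "nat \<Rightarrow> real \<Rightarrow> (nat \<Rightarrow> real) \<Rightarrow> nat \<Rightarrow> int" where
  "round_to_grid n h y = (\<lambda>i\<in>{..<n}. toward_zero (y i / h))"

lemma round_to_grid:
  assumes "0 < h" "i < n"
  shows "h * \<bar>real_of_int (round_to_grid n h y i)\<bar> \<le> \<bar>y i\<bar>"
    and "\<bar>y i - h * round_to_grid n h y i\<bar> \<le> h"
    and "round_to_grid n h y i = 0 \<longleftrightarrow> \<bar>y i\<bar> < h"
proof -
  show "h * \<bar>real_of_int (round_to_grid n h y i)\<bar> \<le> \<bar>y i\<bar>"
    using abs_toward_zero_le[of "y i / h"] assms
    by (simp add: round_to_grid_def abs_divide pos_le_divide_eq mult.commute)
  have "\<bar>y i - h * round_to_grid n h y i\<bar> = h * \<bar>y i / h - real_of_int (toward_zero (y i / h))\<bar>"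
  proof -
    have "y i - h * round_to_grid n h y i = h * (y i / h - real_of_int (toward_zero (y i / h)))"
      using assms by (simp add: round_to_grid_def right_diff_distrib)
    thus ?thesis using assms by (simp only: abs_mult abs_of_pos)
  qed
  also have "\<dots> \<le> h * 1" using toward_zero_error assms by (intro mult_left_mono) auto
  finally show "\<bar>y i - h * round_to_grid n h y i\<bar> \<le> h" by simp
  show "round_to_grid n h y i = 0 \<longleftrightarrow> \<bar>y i\<bar> < h"
    using assms by (simp add: round_to_grid_def toward_zero_eq_0_iff abs_divide)
qed

text \<open>Cauchy-Schwarz on the support: an entry outside \<open>S\<close> is below the mesh and
  rounds to 0.\<close>

lemma round_to_grid_sum_abs_le:
  assumes "0 < h" "S \<subseteq> {..<n}" "\<And>i. i < n \<Longrightarrow> i \<notin> S \<Longrightarrow> \<bar>y i\<bar> < h" "(\<Sum>i<n. (y i)\<^sup>2) \<le> 1"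
  shows "real_of_int (\<Sum>i<n. \<bar>round_to_grid n h y i\<bar>) \<le> sqrt (real (card S)) / h"
proof -
  have fS: "finite S" using assms finite_subset by blast
  have "(\<Sum>i<n. \<bar>round_to_grid n h y i\<bar>) = (\<Sum>i\<in>S. \<bar>round_to_grid n h y i\<bar>)"
    using assms by (intro sum.mono_neutral_right) (auto simp: round_to_grid(3))
  also have "real_of_int \<dots> \<le> (\<Sum>i\<in>S. \<bar>y i\<bar> / h)"
    unfolding of_int_sum of_int_abs
    using assms round_to_grid(1)[of h _ n y] by (intro sum_mono) (auto simp: field_simps)
  also have "\<dots> = (\<Sum>i\<in>S. \<bar>1\<bar> * \<bar>y i\<bar>) / h" by (simp add: sum_divide_distrib)
  also have "\<dots> \<le> (L2_set (\<lambda>_. 1) S * L2_set y S) / h"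
    using assms by (intro divide_right_mono L2_set_mult_ineq) auto
  also have "\<dots> \<le> (sqrt (real (card S)) * 1) / h"
  proof (intro divide_right_mono mult_mono)
    have "(\<Sum>i\<in>S. (y i)\<^sup>2) \<le> (\<Sum>i<n. (y i)\<^sup>2)" using assms by (intro sum_mono2) auto
    thus "L2_set y S \<le> 1" using assms by (simp add: L2_set_def)
  qed (use assms in \<open>auto simp: L2_set_def intro: sum_nonneg\<close>)
  finally show ?thesis by simp
qed

section \<open>Sums over pairs and bilinear forms\<close>

lemma sum_vertex_pairs:
  fixes g :: "nat set \<Rightarrow> real"
  shows "(\<Sum>i<n. \<Sum>j\<in>{..<n}-{i}. g {i, j}) = 2 * (\<Sum>e\<in>vertex_pairs n. g e)"
proof -
  let ?S = "SIGMA i:{..<n}. {..<n} - {i}"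
  have "(\<Sum>i<n. \<Sum>j\<in>{..<n}-{i}. g {i, j}) = (\<Sum>x\<in>?S. g {fst x, snd x})"
    by (subst sum.Sigma) (auto simp: case_prod_unfold)
  also have "\<dots> = (\<Sum>e\<in>vertex_pairs n. \<Sum>x\<in>{x \<in> ?S. {fst x, snd x} = e}. g {fst x, snd x})"
    by (intro sum.group[symmetric]) (auto simp: pair_in_vertex_pairs_iff)
  also have "\<dots> = (\<Sum>e\<in>vertex_pairs n. 2 * g e)"
  proof (intro sum.cong refl)
    fix e assume e: "e \<in> vertex_pairs n"
    then obtain a b where ab: "e = {a, b}" "a \<noteq> b" "a < n" "b < n"
      by (auto simp: vertex_pairs_def card_2_iff)
    have "{x \<in> ?S. {fst x, snd x} = e} = {(a, b), (b, a)}"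
      using ab by (auto simp: doubleton_eq_iff)
    thus "(\<Sum>x\<in>{x \<in> ?S. {fst x, snd x} = e}. g {fst x, snd x}) = 2 * g e"
      using ab by (simp add: insert_commute)
  qed
  finally show ?thesis by (simp add: sum_distrib_left)
qed

definition bilin :: "nat \<Rightarrow> (nat \<Rightarrow> nat \<Rightarrow> real) \<Rightarrow> (nat \<Rightarrow> real) \<Rightarrow> (nat \<Rightarrow> real) \<Rightarrow> real" where
  "bilin n w x y = (\<Sum>i<n. \<Sum>j<n. x i * w i j * y j)"

lemma bilin_scale: "bilin n w (\<lambda>i. a * x i) (\<lambda>i. b * y i) = a * b * bilin n w x y"
  by (simp add: bilin_def sum_distrib_left mult_ac)

lemma bilin_commute:
  assumes "\<And>i j. w i j = w j i"
  shows "bilin n w x y = bilin n w y x"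
  unfolding bilin_def by (subst sum.swap) (use assms in \<open>auto intro!: sum.cong\<close>)

lemma bilin_add_diff:
  "bilin n w (\<lambda>i. x i + y i) z = bilin n w x z + bilin n w y z"
  "bilin n w (\<lambda>i. x i - y i) z = bilin n w x z - bilin n w y z"
  "bilin n w x (\<lambda>i. y i + z i) = bilin n w x y + bilin n w x z"
  "bilin n w x (\<lambda>i. y i - z i) = bilin n w x y - bilin n w x z"
  by (simp_all add: bilin_def distrib_left distrib_right left_diff_distrib right_diff_distrib
      sum.distrib sum_subtractf)

lemma bilin_polarization:
  assumes "\<And>i j. w i j = w j i"
  shows "4 * bilin n w x y = bilin n w (\<lambda>i. x i + y i) (\<lambda>i. x i + y i)
    - bilin n w (\<lambda>i. x i - y i) (\<lambda>i. x i - y i)"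
  using bilin_commute[of w n x y] assms by (simp add: bilin_add_diff)

text \<open>Polarization followed by the parallelogram law.\<close>

lemma bilin_le_of_quad:
  assumes sym: "\<And>i j. w i j = w j i"
    and B: "\<And>x. \<bar>bilin n w x x\<bar> \<le> B * (\<Sum>i<n. (x i)\<^sup>2)"
  shows "\<bar>bilin n w x y\<bar> \<le> B / 2 * ((\<Sum>i<n. (x i)\<^sup>2) + (\<Sum>i<n. (y i)\<^sup>2))"
proof -
  have "4 * \<bar>bilin n w x y\<bar> \<le> B * (\<Sum>i<n. (x i + y i)\<^sup>2) + B * (\<Sum>i<n. (x i - y i)\<^sup>2)"
    using bilin_polarization[of w n x y] sym B[of "\<lambda>i. x i + y i"] B[of "\<lambda>i. x i - y i"] by simp
  also have "\<dots> = B * (\<Sum>i<n. (x i + y i)\<^sup>2 + (x i - y i)\<^sup>2)"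
    by (simp only: sum.distrib distrib_left)
  also have "\<dots> = B * (\<Sum>i<n. 2 * (x i)\<^sup>2 + 2 * (y i)\<^sup>2)"
    by (simp add: power2_sum power2_diff)
  also have "\<dots> = 2 * B * ((\<Sum>i<n. (x i)\<^sup>2) + (\<Sum>i<n. (y i)\<^sup>2))"
    by (simp add: sum.distrib distrib_left flip: sum_distrib_left)
  finally show ?thesis by simp
qed

text \<open>Let \<open>z\<close> be the image of \<open>y\<close>. The bilinear bound at
  \<open>z / B\<close> and \<open>y\<close> has on its right half of the term in \<open>z\<close>
  that stands on its left, so this term can be absorbed.\<close>

lemma matrix_norm_le_of_quad:
  assumes sym: "\<And>i j. w i j = w j i"
    and B: "\<And>x. \<bar>bilin n w x x\<bar> \<le> B * (\<Sum>i<n. (x i)\<^sup>2)" "0 < B"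
  shows "(\<Sum>i<n. (\<Sum>j<n. w i j * y j)\<^sup>2) \<le> B\<^sup>2 * (\<Sum>i<n. (y i)\<^sup>2)"
proof -
  define z where "z i = (\<Sum>j<n. w i j * y j)" for i
  have "(\<Sum>i<n. (z i)\<^sup>2) = bilin n w z y"
    unfolding bilin_def z_def by (simp add: power2_eq_square sum_distrib_left mult_ac)
  hence "(1 / B) * (\<Sum>i<n. (z i)\<^sup>2) = bilin n w (\<lambda>i. 1 / B * z i) (\<lambda>i. 1 * y i)"
    by (subst bilin_scale) simp
  also have "\<dots> \<le> B / 2 * ((\<Sum>i<n. (1 / B * z i)\<^sup>2) + (\<Sum>i<n. (y i)\<^sup>2))"
    using bilin_le_of_quad[OF sym B(1), of "\<lambda>i. 1 / B * z i" y] by simp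
  also have "(\<Sum>i<n. (1 / B * z i)\<^sup>2) = 1 / B\<^sup>2 * (\<Sum>i<n. (z i)\<^sup>2)"
    by (simp add: power_mult_distrib power_divide sum_distrib_left)
  finally have "(1 / B) * (\<Sum>i<n. (z i)\<^sup>2) \<le> B / 2 * (1 / B\<^sup>2 * (\<Sum>i<n. (z i)\<^sup>2) + (\<Sum>i<n. (y i)\<^sup>2))" .
  hence "(\<Sum>i<n. (z i)\<^sup>2) \<le> B\<^sup>2 * (\<Sum>i<n. (y i)\<^sup>2)"
    using B(2) by (simp add: field_simps power2_eq_square)
  thus ?thesis by (simp add: z_def)
qed

text \<open>Rounding towards zero does not increase the norm, so the supremum \<open>B\<close> of the quadratic form
  over the unit ball satisfies \<open>B \<le> b + 5 / 8 * B\<close>, where \<open>b\<close> bounds it on the grid.\<close>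

lemma quad_le_of_grid:
  assumes sym: "\<And>i j. w i j = w j i" and n: "0 < n" and w: "\<And>i j. \<bar>w i j\<bar> \<le> 1"
    and grid: "\<And>k. \<lbrakk>k \<in> grid n (4 * real n) (real n); (\<Sum>i<n. (real_of_int (k i) / (4 * sqrt n))\<^sup>2) \<le> 1\<rbrakk> \<Longrightarrow>
      \<bar>bilin n w (\<lambda>i. real_of_int (k i) / (4 * sqrt n)) (\<lambda>i. real_of_int (k i) / (4 * sqrt n))\<bar> \<le> b"
  shows "\<bar>bilin n w x x\<bar> \<le> 8 / 3 * b * (\<Sum>i<n. (x i)\<^sup>2)"
proof -
  define U where "U = {x :: nat \<Rightarrow> real. (\<Sum>i<n. (x i)\<^sup>2) \<le> 1}"
  define B where "B = (SUP x\<in>U. \<bar>bilin n w x x\<bar>)"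
  have ne: "(\<lambda>_. 0) \<in> U" by (simp add: U_def)
  \<comment> \<open>The supremum defining \<open>B\<close> is meaningful only for a bounded set; the
    trivial bound by the number of entries suffices.\<close>
  have bdd: "bdd_above ((\<lambda>x. \<bar>bilin n w x x\<bar>) ` U)"
  proof (rule bdd_aboveI2)
    fix x assume x: "x \<in> U"
    have xi: "\<bar>x i\<bar> \<le> 1" if "i < n" for i
    proof -
      have "(x i)\<^sup>2 \<le> (\<Sum>i<n. (x i)\<^sup>2)" using that by (intro member_le_sum) auto
      also have "\<dots> \<le> 1" using x by (simp add: U_def)
      finally show ?thesis by (simp add: abs_square_le_1)
    qed
    have "\<bar>bilin n w x x\<bar> \<le> (\<Sum>i<n. \<Sum>j<n. \<bar>x i * w i j * x j\<bar>)"
      unfolding bilin_def by (intro order_trans[OF sum_abs] sum_mono sum_abs)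
    also have "\<dots> \<le> (\<Sum>i<n. \<Sum>j<n. 1 * 1 * 1)"
      unfolding abs_mult using xi w by (intro sum_mono mult_mono) auto
    finally show "\<bar>bilin n w x x\<bar> \<le> (\<Sum>i<n. \<Sum>j<n. 1 * 1 * 1)" .
  qed
  have upper: "\<bar>bilin n w x x\<bar> \<le> B" if "x \<in> U" for x
    unfolding B_def using that bdd by (intro cSUP_upper)
  have all: "\<bar>bilin n w x x\<bar> \<le> B * (\<Sum>i<n. (x i)\<^sup>2)" for x
  proof (cases "(\<Sum>i<n. (x i)\<^sup>2) = 0")
    case True
    hence "\<And>i. i < n \<Longrightarrow> x i = 0" by (simp add: sum_nonneg_eq_0_iff)
    hence "bilin n w x x = 0" by (simp add: bilin_def)
    thus ?thesis using True by simp
  next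
    case False
    define s where "s = (\<Sum>i<n. (x i)\<^sup>2)"
    have s: "s > 0" using False by (simp add: s_def order.not_eq_order_implies_strict sum_nonneg)
    have "(\<Sum>i<n. (1 / sqrt s * x i)\<^sup>2) = 1 / s * (\<Sum>i<n. (x i)\<^sup>2)"
      using s by (simp add: power_divide sum_divide_distrib)
    hence "(\<lambda>i. 1 / sqrt s * x i) \<in> U" using s by (simp add: U_def flip: s_def)
    from upper[OF this] have "\<bar>1 / s * bilin n w x x\<bar> \<le> B"
      using s unfolding bilin_scale by simp
    thus ?thesis using s by (simp add: abs_mult pos_divide_le_eq flip: s_def)
  qed
  have step: "\<bar>bilin n w x x\<bar> \<le> b + 5 / 8 * B" if x: "x \<in> U" for x
  proof -
    define h where "h = 1 / (4 * sqrt (real n))"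
    have h: "h > 0" using n by (simp add: h_def)
    define k where "k = round_to_grid n h x"
    define z where "z i = real_of_int (k i) / (4 * sqrt n)" for i
    have zk: "z i = h * k i" for i by (simp add: z_def h_def)
    have zx: "\<bar>z i\<bar> \<le> \<bar>x i\<bar>" "\<bar>x i - z i\<bar> \<le> h" if "i < n" for i
      using round_to_grid(1,2)[OF h that, of x] h by (auto simp: zk k_def abs_mult)
    have "real_of_int (\<Sum>i<n. \<bar>k i\<bar>) \<le> sqrt (real (card {..<n})) / h"
      unfolding k_def using x h by (intro round_to_grid_sum_abs_le) (auto simp: U_def)
    also have "\<dots> = 4 * real n" by (simp add: h_def)
    finally have "real_of_int (\<Sum>i<n. \<bar>k i\<bar>) \<le> 4 * real n" .
    moreover have "k \<in> extensional {..<n}" by (simp add: k_def round_to_grid_def)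
    moreover have "card {i \<in> {..<n}. k i \<noteq> 0} \<le> card {..<n}" by (intro card_mono) auto
    ultimately have "k \<in> grid n (4 * real n) (real n)" by (simp add: grid_def)
    moreover have zU: "(\<Sum>i<n. (z i)\<^sup>2) \<le> (\<Sum>i<n. (x i)\<^sup>2)"
      using zx by (intro sum_mono) (auto simp: power2_le_iff_abs_le abs_le_square_iff)
    ultimately have b: "\<bar>bilin n w z z\<bar> \<le> b"
      using grid[of k] x by (simp add: U_def z_def[abs_def])
    have "bilin n w x x - bilin n w z z = bilin n w (\<lambda>i. x i - z i) (\<lambda>i. x i + z i)"
      using bilin_commute[of w n x z] sym by (simp add: bilin_add_diff)
    \<comment> \<open>Scaling by 2 and 1/2 balances the two vectors: their squared norms become at
      most 4 n h^2 = 1/4 and 1, which produces the factor 5/8.\<close>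
    also have "\<dots> = bilin n w (\<lambda>i. 2 * (x i - z i)) (\<lambda>i. 1 / 2 * (x i + z i))"
      by (subst bilin_scale) simp
    also have "\<bar>\<dots>\<bar> \<le> B / 2 * ((\<Sum>i<n. (2 * (x i - z i))\<^sup>2) + (\<Sum>i<n. (1 / 2 * (x i + z i))\<^sup>2))"
      by (intro bilin_le_of_quad sym all)
    also have "\<dots> \<le> B / 2 * (1 / 4 + 1)"
    proof (intro mult_left_mono add_mono)
      have "(\<Sum>i<n. (2 * (x i - z i))\<^sup>2) \<le> (\<Sum>i<n. (2 * h)\<^sup>2)"
      proof (intro sum_mono)
        fix i assume "i \<in> {..<n}"
        hence "\<bar>2 * (x i - z i)\<bar> \<le> \<bar>2 * h\<bar>" using zx(2)[of i] h by (simp add: abs_mult)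
        thus "(2 * (x i - z i))\<^sup>2 \<le> (2 * h)\<^sup>2" by (simp only: abs_le_square_iff)
      qed
      also have "\<dots> = 1 / 4" using n by (simp add: h_def power_divide)
      finally show "(\<Sum>i<n. (2 * (x i - z i))\<^sup>2) \<le> 1 / 4" .
      have "(\<Sum>i<n. (1 / 2 * (x i + z i))\<^sup>2) \<le> (\<Sum>i<n. (x i)\<^sup>2)"
      proof (intro sum_mono)
        fix i assume "i \<in> {..<n}"
        hence "\<bar>1 / 2 * (x i + z i)\<bar> \<le> \<bar>x i\<bar>" using zx(1)[of i] by auto
        thus "(1 / 2 * (x i + z i))\<^sup>2 \<le> (x i)\<^sup>2" by (simp only: abs_le_square_iff)
      qed
      thus "(\<Sum>i<n. (1 / 2 * (x i + z i))\<^sup>2) \<le> 1" using x by (simp add: U_def)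
    qed (use upper[OF ne] in auto)
    also have "B / 2 * (1 / 4 + 1) = 5 / 8 * B" by simp
    finally show ?thesis
      using b abs_triangle_ineq2[of "bilin n w x x" "bilin n w z z"] by linarith
  qed
  have "B \<le> b + 5 / 8 * B"
    unfolding B_def using ne by (intro cSUP_least) (use step in \<open>auto simp: B_def\<close>)
  hence "B \<le> 8 / 3 * b" by simp
  hence "B * (\<Sum>i<n. (x i)\<^sup>2) \<le> 8 / 3 * b * (\<Sum>i<n. (x i)\<^sup>2)"
    by (intro mult_right_mono sum_nonneg) auto
  thus ?thesis using all[of x] by linarith
qed

section \<open>The norm of \<open>A - p J\<close> for a random graph\<close>

text \<open>The matrix is A - p J with J all ones, so a loopless graph has \<open>- p\<close> on its
  diagonal. Keeping this diagonal makes A = W + p J exact, where W denotes the centred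
  matrix.\<close>

definition centered_adj :: "real \<Rightarrow> nat set set \<Rightarrow> nat \<Rightarrow> nat \<Rightarrow> real" where
  "centered_adj p E i j = of_bool ({i, j} \<in> E) - p"

lemma centered_adj_sym: "centered_adj p E i j = centered_adj p E j i"
  by (simp add: centered_adj_def insert_commute)

text \<open>The shape that Hoeffding's inequality requires: a sum over independent edges, plus the
  deterministic contribution of the diagonal.\<close>

lemma centered_adj_quad:
  "bilin n (centered_adj p (edges_of n \<omega>)) x x =
     (\<Sum>e\<in>vertex_pairs n. (2 * (\<Prod>i\<in>e. x i)) * (of_bool (\<omega> e) - p)) - p * (\<Sum>i<n. (x i)\<^sup>2)"
proof -
  let ?w = "centered_adj p (edges_of n \<omega>)"
  let ?g = "\<lambda>e. (\<Prod>i\<in>e. x i) * (of_bool (\<omega> e) - p)"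
  have "bilin n ?w x x = (\<Sum>i<n. x i * ?w i i * x i + (\<Sum>j\<in>{..<n}-{i}. x i * ?w i j * x j))"
    unfolding bilin_def by (intro sum.cong refl sum.remove) auto
  also have "\<dots> = (\<Sum>i<n. - p * (x i)\<^sup>2 + (\<Sum>j\<in>{..<n}-{i}. ?g {i, j}))"
    by (intro sum.cong refl arg_cong2[where f = "(+)"])
      (auto simp: centered_adj_def edges_of_def pair_in_vertex_pairs_iff power2_eq_square
         vertex_pairs_def)
  also have "\<dots> = 2 * (\<Sum>e\<in>vertex_pairs n. ?g e) - p * (\<Sum>i<n. (x i)\<^sup>2)"
    unfolding sum.distrib sum_vertex_pairs[of ?g n] by (simp add: sum_negf sum_distrib_left)
  finally show ?thesis by (simp add: sum_distrib_left mult_ac)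
qed

text \<open>Bounds the sum of squared coefficients that enters Hoeffding's inequality for the
  quadratic form.\<close>

lemma sum_vertex_pairs_prod_sq_le:
  fixes x :: "nat \<Rightarrow> real"
  shows "(\<Sum>e\<in>vertex_pairs n. (2 * (\<Prod>i\<in>e. x i))\<^sup>2) \<le> 2 * (\<Sum>i<n. (x i)\<^sup>2)\<^sup>2"
proof -
  let ?g = "\<lambda>e. (\<Prod>i\<in>e. (x i)\<^sup>2)"
  have "(\<Sum>e\<in>vertex_pairs n. (2 * (\<Prod>i\<in>e. x i))\<^sup>2) = 2 * (2 * (\<Sum>e\<in>vertex_pairs n. ?g e))"
    by (simp add: power_mult_distrib prod_power_distrib sum_distrib_left)
  also have "2 * (\<Sum>e\<in>vertex_pairs n. ?g e) = (\<Sum>i<n. \<Sum>j\<in>{..<n}-{i}. ?g {i, j})"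
    by (rule sum_vertex_pairs[symmetric])
  also have "\<dots> = (\<Sum>i<n. \<Sum>j\<in>{..<n}-{i}. (x i)\<^sup>2 * (x j)\<^sup>2)"
    by (intro sum.cong) auto
  also have "\<dots> \<le> (\<Sum>i<n. \<Sum>j<n. (x i)\<^sup>2 * (x j)\<^sup>2)"
    by (intro sum_mono sum_mono2) auto
  also have "\<dots> = (\<Sum>i<n. (x i)\<^sup>2)\<^sup>2" by (simp add: power2_eq_square sum_product)
  finally show ?thesis by simp
qed

lemma prob_UN_le:
  assumes "finite I" "\<And>i. i \<in> I \<Longrightarrow> measure_pmf.prob M (A i) \<le> b"
  shows "measure_pmf.prob M (\<Union>i\<in>I. A i) \<le> real (card I) * b"
proof -
  have "measure_pmf.prob M (\<Union>i\<in>I. A i) \<le> (\<Sum>i\<in>I. measure_pmf.prob M (A i))"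
    using assms(1) by (intro measure_pmf.finite_measure_subadditive_finite) auto
  also have "\<dots> \<le> (\<Sum>i\<in>I. b)" by (intro sum_mono assms)
  finally show ?thesis by simp
qed

definition quad_bounded :: "nat \<Rightarrow> real \<Rightarrow> nat set set \<Rightarrow> bool" where
  "quad_bounded n p E \<longleftrightarrow>
     (\<forall>x. \<bar>bilin n (centered_adj p E) x x\<bar> \<le> 11 * sqrt n * (\<Sum>i<n. (x i)\<^sup>2))"

text \<open>Union bound over a grid of at most 2^(4n) 3^n = 48^n vectors of norm at most 1. Each of
  them exceeds \<open>3 * sqrt n\<close> with probability at most 2 exp (-9 n) <= 2 / 512^n, and 48
  / 512 = 3 / 32.\<close>

lemma prob_not_quad_bounded:
  assumes p: "0 \<le> p" "p \<le> 1" and n: "0 < n"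
  shows "measure_pmf.prob (coin_flips (vertex_pairs n) p) {\<omega>. \<not> quad_bounded n p (edges_of n \<omega>)}
    \<le> 2 * (3 / 32) ^ n"
proof -
  let ?Q = "coin_flips (vertex_pairs n) p"
  define z where "z k i = real_of_int (k i) / (4 * sqrt n)" for k :: "nat \<Rightarrow> int" and i
  define G where "G = {k \<in> grid n (4 * real n) (real n). (\<Sum>i<n. (z k i)\<^sup>2) \<le> 1}"
  define b where "b = 3 * sqrt n"
  define Bad where "Bad k = {\<omega>. b \<le> \<bar>\<Sum>e\<in>vertex_pairs n. (2 * (\<Prod>i\<in>e. z k i)) * (of_bool (\<omega> e) - p)\<bar>}" for k
  have fG: "finite G" using grid_card(1)[of 1 1] by (simp add: G_def)
  have cG: "real (card G) \<le> 48 ^ n"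
  proof -
    have "card G \<le> card (grid n (4 * real n) (real n))"
      using grid_card(1)[of 1 1] by (intro card_mono) (auto simp: G_def)
    also have "real \<dots> \<le> (1 + 1) powr (4 * real n) * (1 / 1) powr real n * (1 + 2 * 1 / 1) ^ n"
      by (rule grid_card(2)) auto
    also have "(1 + 1) powr (4 * real n) = (16::real) ^ n"
    proof -
      have "(1 + 1) powr (4 * real n) = (2::real) powr (real (4 * n))" by simp
      also have "\<dots> = 2 ^ (4 * n)" by (rule powr_realpow) simp
      finally show ?thesis by (simp add: power_mult)
    qed
    finally show ?thesis by (simp flip: power_mult_distrib)
  qed
  have "{\<omega>. \<not> quad_bounded n p (edges_of n \<omega>)} \<subseteq> (\<Union>k\<in>G. Bad k)"
  proof (rule ccontr)
    assume "\<not> ?thesis"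
    then obtain \<omega> where \<omega>: "\<not> quad_bounded n p (edges_of n \<omega>)" "\<And>k. k \<in> G \<Longrightarrow> \<omega> \<notin> Bad k" by auto
    have "\<bar>bilin n (centered_adj p (edges_of n \<omega>)) x x\<bar> \<le> 8 / 3 * (b + 1) * (\<Sum>i<n. (x i)\<^sup>2)" for x
    proof (rule quad_le_of_grid[OF centered_adj_sym n])
      show "\<bar>centered_adj p (edges_of n \<omega>) i j\<bar> \<le> 1" for i j
        using p by (auto simp: centered_adj_def)
      fix k assume k: "k \<in> grid n (4 * real n) (real n)"
        "(\<Sum>i<n. (real_of_int (k i) / (4 * sqrt n))\<^sup>2) \<le> 1"
      hence kG: "k \<in> G" by (simp add: G_def z_def)
      have "p * (\<Sum>i<n. (z k i)\<^sup>2) \<le> 1 * 1"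
        using p kG by (intro mult_mono) (auto simp: G_def sum_nonneg)
      moreover have "0 \<le> p * (\<Sum>i<n. (z k i)\<^sup>2)" using p by (simp add: sum_nonneg)
      ultimately have "\<bar>bilin n (centered_adj p (edges_of n \<omega>)) (z k) (z k)\<bar> \<le> b + 1"
        using \<omega>(2)[OF kG] unfolding centered_adj_quad Bad_def by auto
      thus "\<bar>bilin n (centered_adj p (edges_of n \<omega>)) (\<lambda>i. real_of_int (k i) / (4 * sqrt n))
         (\<lambda>i. real_of_int (k i) / (4 * sqrt n))\<bar> \<le> b + 1" by (simp add: z_def[abs_def])
    qed
    \<comment> \<open>Passing from the grid to all vectors costs the factor 8/3; the summand 1 pays
      for the diagonal.\<close>
    moreover have "8 / 3 * (b + 1) \<le> 11 * sqrt n"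
    proof -
      have "1 \<le> sqrt n" using n by simp
      moreover have "8 / 3 * (b + 1) = 8 * sqrt n + 8 / 3" by (simp add: b_def)
      ultimately show ?thesis by linarith
    qed
    ultimately have "\<bar>bilin n (centered_adj p (edges_of n \<omega>)) x x\<bar> \<le> 11 * sqrt n * (\<Sum>i<n. (x i)\<^sup>2)" for x
      by (meson mult_right_mono order_trans sum_nonneg zero_le_power2)
    thus False using \<omega>(1) by (simp add: quad_bounded_def)
  qed
  hence "measure_pmf.prob ?Q {\<omega>. \<not> quad_bounded n p (edges_of n \<omega>)} \<le> measure_pmf.prob ?Q (\<Union>k\<in>G. Bad k)"
    by (intro measure_pmf.finite_measure_mono) auto
  also have "\<dots> \<le> real (card G) * (2 * exp (- 2 * b\<^sup>2 / 2))"
  proof (intro prob_UN_le fG)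
    fix k assume k: "k \<in> G"
    have "2 * (\<Sum>i<n. (z k i)\<^sup>2)\<^sup>2 \<le> 2"
      using k by (simp add: G_def power_le_one sum_nonneg)
    thus "measure_pmf.prob ?Q (Bad k) \<le> 2 * exp (- 2 * b\<^sup>2 / 2)"
      unfolding Bad_def using p n
      by (intro coin_flips_tail order_trans[OF sum_vertex_pairs_prod_sq_le]) (auto simp: b_def)
  qed
  also have "\<dots> \<le> 48 ^ n * (2 * exp (- 2 * b\<^sup>2 / 2))" using cG by (intro mult_right_mono) auto
  also have "exp (- 2 * b\<^sup>2 / 2) = exp (real n * (- 9))" by (simp add: b_def power_mult_distrib)
  also have "\<dots> = exp (- 9) ^ n" by (rule exp_of_nat_mult)
  also have "\<dots> \<le> (1 / 512) ^ n"
  proof (rule power_mono)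
    have "(2::real) ^ 9 \<le> exp 1 ^ 9" using exp_ge_add_one_self[of 1] by (intro power_mono) auto
    also have "\<dots> = exp 9" by (simp flip: exp_of_nat_mult)
    finally show "exp (- 9) \<le> (1 / 512 :: real)" by (simp add: exp_minus field_simps)
  qed simp
  finally have "measure_pmf.prob ?Q {\<omega>. \<not> quad_bounded n p (edges_of n \<omega>)} \<le> 48 ^ n * (2 * (1 / 512) ^ n)"
    by simp
  also have "\<dots> = 2 * (48 * (1 / 512)) ^ n" by (simp only: power_mult_distrib mult_ac)
  finally show ?thesis by simp
qed

section \<open>Degrees\<close>

lemma degree_of_eq:
  assumes "i < n"
  shows "real (degree_of n (edges_of n \<omega>) i) = (\<Sum>e\<in>(\<lambda>j. {i, j}) ` ({..<n} - {i}). of_bool (\<omega> e))"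
proof -
  have inj: "inj_on (\<lambda>j. {i, j}) ({..<n} - {i})" by (auto simp: inj_on_def doubleton_eq_iff)
  have "{j \<in> {..<n}. {i, j} \<in> edges_of n \<omega>} = {j \<in> {..<n} - {i}. \<omega> {i, j}}"
    using assms by (auto simp: edges_of_def pair_in_vertex_pairs_iff)
  hence "real (degree_of n (edges_of n \<omega>) i) = (\<Sum>j\<in>{..<n} - {i}. of_bool (\<omega> {i, j}))"
    by (simp add: degree_of_def sum_of_bool_eq Int_def)
  also have "\<dots> = (\<Sum>e\<in>(\<lambda>j. {i, j}) ` ({..<n} - {i}). of_bool (\<omega> e))"
    by (simp add: sum.reindex[OF inj])
  finally show ?thesis .
qed

text \<open>Hoeffding's inequality at each vertex. The mean degree is (n - 1) p rather than n p, and
  \<open>4 \<le> n\<close> ensures that a degree below \<open>n * p / 2\<close> still deviates by at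
  least \<open>n * p / 4\<close>.\<close>

lemma prob_low_degree:
  assumes p: "0 < p" "p \<le> 1" and n: "4 \<le> n"
  shows "measure_pmf.prob (coin_flips (vertex_pairs n) p)
      {\<omega>. \<exists>i<n. real (degree_of n (edges_of n \<omega>) i) < real n * p / 2}
    \<le> real n * (2 * exp (- (p\<^sup>2 / 8)) ^ n)"
proof -
  let ?Q = "coin_flips (vertex_pairs n) p"
  define A where "A i = (\<lambda>j. {i, j}) ` ({..<n} - {i})" for i :: nat
  define Bad where "Bad i = {\<omega>. real n * p / 4 \<le> \<bar>\<Sum>e\<in>A i. 1 * (of_bool (\<omega> e) - p)\<bar>}" for i
  have cA: "card (A i) = n - 1" if "i < n" for i
    unfolding A_def using that by (subst card_image) (auto simp: inj_on_def doubleton_eq_iff)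
  have "{\<omega>. \<exists>i<n. real (degree_of n (edges_of n \<omega>) i) < real n * p / 2} \<subseteq> (\<Union>i\<in>{..<n}. Bad i)"
  proof safe
    fix \<omega> i assume i: "i < n" "real (degree_of n (edges_of n \<omega>) i) < real n * p / 2"
    have "(\<Sum>e\<in>A i. 1 * (of_bool (\<omega> e) - p)) = real (degree_of n (edges_of n \<omega>) i) - (real n - 1) * p"
      using i cA[of i] by (simp add: degree_of_eq A_def sum_subtractf of_nat_diff)
    also have "\<dots> \<le> - (real n * p / 4)"
    proof -
      have "4 * p \<le> real n * p" using n p by (intro mult_right_mono) auto
      thus ?thesis using i(2) by (simp add: algebra_simps)
    qed
    finally have "\<omega> \<in> Bad i" by (simp add: Bad_def)
    thus "\<omega> \<in> (\<Union>i\<in>{..<n}. Bad i)" using i by auto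
  qed
  hence "measure_pmf.prob ?Q {\<omega>. \<exists>i<n. real (degree_of n (edges_of n \<omega>) i) < real n * p / 2}
    \<le> measure_pmf.prob ?Q (\<Union>i\<in>{..<n}. Bad i)"
    by (intro measure_pmf.finite_measure_mono) auto
  also have "\<dots> \<le> real (card {..<n}) * (2 * exp (- 2 * (real n * p / 4)\<^sup>2 / real n))"
  proof (intro prob_UN_le)
    fix i assume "i \<in> {..<n}"
    thus "measure_pmf.prob ?Q (Bad i) \<le> 2 * exp (- 2 * (real n * p / 4)\<^sup>2 / real n)"
      unfolding Bad_def using p n cA[of i]
      by (intro coin_flips_tail) (auto simp: A_def pair_in_vertex_pairs_iff)
  qed simp
  also have "- 2 * (real n * p / 4)\<^sup>2 / real n = real n * (- (p\<^sup>2 / 8))"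
    using n by (simp add: power2_eq_square field_simps)
  also have "exp (real n * (- (p\<^sup>2 / 8))) = exp (- (p\<^sup>2 / 8)) ^ n" by (rule exp_of_nat_mult)
  finally show ?thesis by (simp only: card_lessThan)
qed

section \<open>Small ball probabilities for matrix rows\<close>

text \<open>Coins are indexed by edges, coefficients of a vector by vertices. For a fixed row
  \<open>i\<close> the injective map from \<open>j\<close> to \<open>{i, j}\<close> translates
  between the two.\<close>

lemma sum_reindex_coefficients:
  fixes c :: "'i \<Rightarrow> real"
  assumes "inj_on f T" "B \<subseteq> T"
  shows "(\<Sum>j\<in>B. F (c j) (f j)) = (\<Sum>e\<in>f ` B. F (c (inv_into T f e)) e)"
proof -
  have "inj_on f B" using assms inj_on_subset by blast
  moreover have "inv_into T f (f j) = j" if "j \<in> B" for j using assms that by auto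
  ultimately show ?thesis by (simp add: sum.reindex)
qed

lemma gaussian_small_ball_spread_indexed:
  fixes c :: "'i \<Rightarrow> real"
  assumes V: "finite V" "f ` T \<subseteq> V" "inj_on f T" and p: "0 < p" "p < 1" and B: "B \<subseteq> T"
    and r: "0 < r" "\<And>j. j \<in> B \<Longrightarrow> \<bar>c j\<bar> \<le> r"
    and \<beta>: "0 < \<beta>" "\<beta> \<le> (\<Sum>j\<in>B. (c j)\<^sup>2)"
  shows "measure_pmf.expectation (coin_flips V p)
           (\<lambda>\<omega>. exp (- (((\<Sum>j\<in>T. c j * of_bool (\<omega> (f j))) + s)\<^sup>2 / 2)))
         \<le> sqrt (2 / (p * (1 - p) * \<beta>)) + r\<^sup>2"
proof -
  let ?c = "\<lambda>e. c (inv_into T f e)"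
  have "(\<Sum>j\<in>T. c j * of_bool (\<omega> (f j))) = (\<Sum>e\<in>f ` T. ?c e * of_bool (\<omega> e))" for \<omega>
    using sum_reindex_coefficients[OF V(3) subset_refl, of "\<lambda>x e. x * of_bool (\<omega> e)"] .
  moreover have "(\<Sum>j\<in>B. (c j)\<^sup>2) = (\<Sum>e\<in>f ` B. (?c e)\<^sup>2)"
    using sum_reindex_coefficients[OF V(3) B, of "\<lambda>x e. x\<^sup>2"] .
  moreover have "\<bar>?c e\<bar> \<le> r" if "e \<in> f ` B" for e
    using that r(2) V(3) B by auto
  ultimately show ?thesis
    using gaussian_small_ball_spread[OF V(1,2) p, of "f ` B" r ?c \<beta> s] B r(1) \<beta> by auto
qed

lemma gaussian_small_ball_const_indexed:
  assumes p: "0 < p" "p < 1"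
  obtains q :: real where "0 < q" "q < 1"
    "\<And>(V :: 'e set) (T :: 'i set) f c s. \<lbrakk>finite V; f ` T \<subseteq> V; inj_on f T;
        \<And>j. j \<in> T \<Longrightarrow> \<bar>c j\<bar> \<le> 1; 1 / 4 \<le> (\<Sum>j\<in>T. (c j)\<^sup>2)\<rbrakk> \<Longrightarrow>
      measure_pmf.expectation (coin_flips V p)
           (\<lambda>\<omega>. exp (- (((\<Sum>j\<in>T. c j * of_bool (\<omega> (f j))) + s)\<^sup>2 / 2))) \<le> q"
proof -
  obtain q :: real where q: "0 < q" "q < 1"
    "\<And>(V :: 'e set) A c s. \<lbrakk>finite V; A \<subseteq> V; \<And>e. e \<in> A \<Longrightarrow> \<bar>c e\<bar> \<le> 1; 1 / 4 \<le> (\<Sum>e\<in>A. (c e)\<^sup>2)\<rbrakk> \<Longrightarrow>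
      measure_pmf.expectation (coin_flips V p)
           (\<lambda>\<omega>. exp (- (((\<Sum>e\<in>A. c e * of_bool (\<omega> e)) + s)\<^sup>2 / 2))) \<le> q"
    using gaussian_small_ball_const[OF p] by blast
  show ?thesis
  proof (rule that[OF q(1,2)])
    fix V :: "'e set" and T :: "'i set" and f and c :: "'i \<Rightarrow> real" and s :: real
    assume V: "finite V" "f ` T \<subseteq> V" "inj_on f T"
      and c: "\<And>j. j \<in> T \<Longrightarrow> \<bar>c j\<bar> \<le> 1" "1 / 4 \<le> (\<Sum>j\<in>T. (c j)\<^sup>2)"
    let ?c = "\<lambda>e. c (inv_into T f e)"
    have "(\<Sum>j\<in>T. c j * of_bool (\<omega> (f j))) = (\<Sum>e\<in>f ` T. ?c e * of_bool (\<omega> e))" for \<omega>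
      using sum_reindex_coefficients[OF V(3) subset_refl, of "\<lambda>x e. x * of_bool (\<omega> e)"] .
    moreover have "(\<Sum>j\<in>T. (c j)\<^sup>2) = (\<Sum>e\<in>f ` T. (?c e)\<^sup>2)"
      using sum_reindex_coefficients[OF V(3) subset_refl, of "\<lambda>x e. x\<^sup>2"] .
    moreover have "\<bar>?c e\<bar> \<le> 1" if "e \<in> f ` T" for e
      using that c(1) V(3) by auto
    ultimately show "measure_pmf.expectation (coin_flips V p)
           (\<lambda>\<omega>. exp (- (((\<Sum>j\<in>T. c j * of_bool (\<omega> (f j))) + s)\<^sup>2 / 2))) \<le> q"
      using q(3)[OF V(1,2), of ?c s] c(2) by auto
  qed
qed

text \<open>Rows outside \<open>T\<close>, restricted to columns in \<open>T\<close>, involve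
  disjoint sets of edges and are independent. The indicator of the event is at most the exponential
  of \<open>L\<close> minus the sum of squares, divided by \<open>2 * \<sigma>\<^sup>2\<close>; its
  expectation factors over the rows.\<close>

lemma prob_rows_small:
  fixes z :: "nat \<Rightarrow> real"
  assumes T: "T \<subseteq> {..<n}" and \<sigma>: "0 < \<sigma>"
    and g: "\<And>i s. i \<in> {..<n} - T \<Longrightarrow>
      measure_pmf.expectation (coin_flips (vertex_pairs n) p)
        (\<lambda>\<omega>. exp (- (((\<Sum>j\<in>T. z j / \<sigma> * of_bool (\<omega> {i, j})) + s)\<^sup>2 / 2))) \<le> g"
  shows "measure_pmf.prob (coin_flips (vertex_pairs n) p)
      {\<omega>. (\<Sum>i\<in>{..<n} - T. ((\<Sum>j\<in>T. centered_adj p (edges_of n \<omega>) i j * z j) + t)\<^sup>2) \<le> L}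
     \<le> exp (L / (2 * \<sigma>\<^sup>2)) * g ^ (n - card T)"
proof -
  let ?Q = "coin_flips (vertex_pairs n) p"
  let ?S = "{..<n} - T"
  have fT: "finite T" using T finite_subset by blast
  define X where "X i \<omega> = (\<Sum>j\<in>T. centered_adj p (edges_of n \<omega>) i j * z j) + t" for i \<omega>
  \<comment> \<open>The centring by \<open>p\<close> and the constant \<open>t\<close> shift every
    row by the same amount, and the hypothesis on \<open>g\<close> is uniform in shifts.\<close>
  define s where "s = (t - p * (\<Sum>j\<in>T. z j)) / \<sigma>"
  define F where "F i \<omega> = exp (- (((\<Sum>j\<in>T. z j / \<sigma> * of_bool (\<omega> {i, j})) + s)\<^sup>2 / 2))"
    for i and \<omega> :: "nat set \<Rightarrow> bool"
  define K where "K i = (\<lambda>j. {i, j}) ` T" for i :: nat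
  have F: "F i \<omega> = exp (- ((X i \<omega>)\<^sup>2 / (2 * \<sigma>\<^sup>2)))" if i: "i \<in> ?S" for i \<omega>
  proof -
    have "X i \<omega> = (\<Sum>j\<in>T. z j * of_bool (\<omega> {i, j}) - p * z j) + t"
      unfolding X_def using i T
      by (intro arg_cong2[where f = "(+)"] sum.cong)
        (auto simp: centered_adj_def edges_of_def pair_in_vertex_pairs_iff algebra_simps)
    also have "\<dots> = \<sigma> * ((\<Sum>j\<in>T. z j / \<sigma> * of_bool (\<omega> {i, j})) + s)"
      using \<sigma> by (simp add: s_def sum_subtractf sum_distrib_left distrib_left)
    finally have "(X i \<omega>)\<^sup>2 = \<sigma>\<^sup>2 * ((\<Sum>j\<in>T. z j / \<sigma> * of_bool (\<omega> {i, j})) + s)\<^sup>2"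
      by (simp only: power_mult_distrib)
    thus ?thesis using \<sigma> by (simp add: F_def)
  qed
  have prodF: "exp (L / (2 * \<sigma>\<^sup>2)) * (\<Prod>i\<in>?S. F i \<omega>) = exp ((L - (\<Sum>i\<in>?S. (X i \<omega>)\<^sup>2)) / (2 * \<sigma>\<^sup>2))" for \<omega>
  proof -
    have "(\<Prod>i\<in>?S. F i \<omega>) = (\<Prod>i\<in>?S. exp (- ((X i \<omega>)\<^sup>2 / (2 * \<sigma>\<^sup>2))))"
      by (intro prod.cong refl F)
    also have "\<dots> = exp (- ((\<Sum>i\<in>?S. (X i \<omega>)\<^sup>2) / (2 * \<sigma>\<^sup>2)))"
      by (simp add: sum_negf sum_divide_distrib flip: exp_sum)
    finally show ?thesis by (simp add: diff_divide_distrib flip: exp_add)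
  qed
  have "measure_pmf.prob ?Q {\<omega>. (\<Sum>i\<in>?S. (X i \<omega>)\<^sup>2) \<le> L} =
     measure_pmf.expectation ?Q (indicator {\<omega>. (\<Sum>i\<in>?S. (X i \<omega>)\<^sup>2) \<le> L})" by simp
  also have "\<dots> \<le> measure_pmf.expectation ?Q (\<lambda>\<omega>. exp (L / (2 * \<sigma>\<^sup>2)) * (\<Prod>i\<in>?S. F i \<omega>))"
    unfolding prodF by (intro integral_mono integrable_coin_flips) (auto simp: indicator_def)
  also have "\<dots> = exp (L / (2 * \<sigma>\<^sup>2)) * (\<Prod>i\<in>?S. measure_pmf.expectation ?Q (F i))"
  proof -
    have "measure_pmf.expectation ?Q (\<lambda>\<omega>. \<Prod>i\<in>?S. F i \<omega>) = (\<Prod>i\<in>?S. measure_pmf.expectation ?Q (F i))"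
    proof (rule expectation_coin_flips_blocks)
      show "K i \<subseteq> vertex_pairs n" if "i \<in> ?S" for i
        using that T by (auto simp: K_def pair_in_vertex_pairs_iff)
      show "disjoint_family_on K ?S"
        by (auto simp: disjoint_family_on_def K_def doubleton_eq_iff)
      show "F i (restrict \<omega> (K i)) = F i \<omega>" if "i \<in> ?S" for i \<omega>
        by (simp add: F_def K_def cong: sum.cong)
    qed auto
    thus ?thesis by simp
  qed
  also have "\<dots> \<le> exp (L / (2 * \<sigma>\<^sup>2)) * (\<Prod>i\<in>?S. g)"
    using g unfolding F_def
    by (intro mult_left_mono prod_mono) (auto intro!: Bochner_Integration.integral_nonneg)
  also have "(\<Prod>i\<in>?S. g) = g ^ (n - card T)"
    using T fT by (simp add: card_Diff_subset)
  finally show ?thesis by (simp add: X_def)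
qed

section \<open>Union bounds over sparse and spread grid vectors\<close>

definition grid_support :: "nat \<Rightarrow> (nat \<Rightarrow> int) \<Rightarrow> nat set" where
  "grid_support n k = {i \<in> {..<n}. k i \<noteq> 0}"

lemma grid_support_subset: "grid_support n k \<subseteq> {..<n}"
  by (auto simp: grid_support_def)

text \<open>Outside the support of the grid vector \<open>\<tau> k / \<surd>n\<close>, its image under the centred adjacency
  matrix is within distance of order \<open>\<tau> \<surd>n\<close> of a constant vector.\<close>

definition near_constant :: "nat \<Rightarrow> real \<Rightarrow> nat set set \<Rightarrow> real \<Rightarrow> real \<Rightarrow> (nat \<Rightarrow> int) \<Rightarrow> real \<Rightarrow> bool" where
  "near_constant n p E L \<tau> k t \<longleftrightarrow>
     (\<Sum>i\<in>{..<n} - grid_support n k.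
        ((\<Sum>j\<in>grid_support n k. centered_adj p E i j * (\<tau> / sqrt n * k j)) + t)\<^sup>2) \<le> L * \<tau>\<^sup>2 * n"

text \<open>The additive constant is also rounded to the mesh \<open>\<tau>\<close> and confined to
  a bounded interval, so that a union bound can include it.\<close>

definition bad_grid :: "nat \<Rightarrow> real \<Rightarrow> real \<Rightarrow> real \<Rightarrow> real \<Rightarrow> (nat \<Rightarrow> int) set \<Rightarrow> nat set set \<Rightarrow> bool" where
  "bad_grid n p M L \<tau> S E \<longleftrightarrow>
     (\<exists>k\<in>S. \<exists>l::int. \<bar>\<tau> * l\<bar> \<le> M \<and> near_constant n p E L \<tau> k (\<tau> * l))"

text \<open>Union bound over pairs of a grid vector and an integer; at most
  \<open>2 * M / \<tau> + 1\<close> integers are admissible.\<close>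

lemma prob_bad_grid_le:
  assumes \<tau>: "0 < \<tau>" and M: "0 \<le> M" and S: "finite S" and b: "0 \<le> b"
    and near: "\<And>k t. k \<in> S \<Longrightarrow> measure_pmf.prob (coin_flips (vertex_pairs n) p)
      {\<omega>. near_constant n p (edges_of n \<omega>) L \<tau> k t} \<le> b"
  shows "measure_pmf.prob (coin_flips (vertex_pairs n) p) {\<omega>. bad_grid n p M L \<tau> S (edges_of n \<omega>)}
    \<le> real (card S) * ((2 * M / \<tau> + 1) * b)"
proof -
  let ?Q = "coin_flips (vertex_pairs n) p"
  define N where "N = \<lfloor>M / \<tau>\<rfloor>"
  have N: "0 \<le> N" using \<tau> M by (simp add: N_def)
  have l: "l \<in> {-N..N}" if "\<bar>\<tau> * real_of_int l\<bar> \<le> M" for l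
  proof -
    have "\<bar>real_of_int l\<bar> \<le> M / \<tau>" using that \<tau> by (simp add: abs_mult field_simps)
    hence "\<bar>l\<bar> \<le> N" unfolding N_def by (simp add: le_floor_iff)
    thus ?thesis by auto
  qed
  let ?B = "\<lambda>x. {\<omega>. near_constant n p (edges_of n \<omega>) L \<tau> (fst x) (\<tau> * real_of_int (snd x))}"
  have "{\<omega>. bad_grid n p M L \<tau> S (edges_of n \<omega>)} \<subseteq> (\<Union>x\<in>S \<times> {-N..N}. ?B x)"
    using l by (fastforce simp: bad_grid_def)
  hence "measure_pmf.prob ?Q {\<omega>. bad_grid n p M L \<tau> S (edges_of n \<omega>)}
      \<le> measure_pmf.prob ?Q (\<Union>x\<in>S \<times> {-N..N}. ?B x)"
    by (intro measure_pmf.finite_measure_mono) auto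
  also have "\<dots> \<le> real (card (S \<times> {-N..N})) * b"
    using near S by (intro prob_UN_le) auto
  also have "\<dots> = real (card S) * (real_of_int (2 * N + 1) * b)"
    using N by (simp add: card_cartesian_product)
  also have "\<dots> \<le> real (card S) * ((2 * M / \<tau> + 1) * b)"
  proof (intro mult_left_mono mult_right_mono b)
    have "2 * M / \<tau> = 2 * (M / \<tau>)" by simp
    thus "real_of_int (2 * N + 1) \<le> 2 * M / \<tau> + 1"
      using of_int_floor_le[of "M / \<tau>"] unfolding N_def by linarith
  qed auto
  finally show ?thesis .
qed

section \<open>Sparse grid vectors\<close>

text \<open>Meant for roundings of unit vectors with at most \<open>\<delta> * n\<close> coordinates
  above the mesh. Cauchy-Schwarz then gives the bound on the sum of absolute values, and rounding by
  a vector of norm at most 1/2 leaves squared norm at least 1/4.\<close>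

definition sparse_grid :: "nat \<Rightarrow> real \<Rightarrow> real \<Rightarrow> (nat \<Rightarrow> int) set" where
  "sparse_grid n \<delta> \<rho> = {k \<in> grid n (sqrt \<delta> / \<rho> * n) n. real (card (grid_support n k)) \<le> \<delta> * n \<and>
     1 / 4 \<le> (\<Sum>i\<in>grid_support n k. (\<rho> / sqrt n * k i)\<^sup>2) \<and> (\<Sum>i\<in>grid_support n k. (\<rho> / sqrt n * k i)\<^sup>2) \<le> 1}"

text \<open>All rates are multiples of \<open>\<kappa>\<close>. At least n/2 independent rows, each
  costing q = exp (-8 \<kappa>), give exp (-4 \<kappa> n); the tolerance \<open>L\<close> costs exp
  (\<kappa> n) and the number of grid vectors exp (2 \<kappa> n), which leaves exp (-\<kappa>
  n).\<close>

lemma prob_bad_sparse_grid: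
  assumes p: "0 < p" "p < 1" and M: "0 \<le> M" and L: "0 \<le> L"
  obtains \<rho> \<delta> \<kappa> D :: real where "0 < \<rho>" "\<rho> \<le> 1 / 2" "0 < \<delta>" "0 < \<kappa>"
    "\<And>n. measure_pmf.prob (coin_flips (vertex_pairs n) p)
       {\<omega>. bad_grid n p M L \<rho> (sparse_grid n \<delta> \<rho>) (edges_of n \<omega>)} \<le> D * exp (- \<kappa>) ^ n"
proof -
  obtain q :: real where q: "0 < q" "q < 1" and small_ball:
    "\<And>(V :: nat set set) (T :: nat set) f c s. \<lbrakk>finite V; f ` T \<subseteq> V; inj_on f T;
        \<And>j. j \<in> T \<Longrightarrow> \<bar>c j\<bar> \<le> 1; 1 / 4 \<le> (\<Sum>j\<in>T. (c j)\<^sup>2)\<rbrakk> \<Longrightarrow>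
      measure_pmf.expectation (coin_flips V p)
           (\<lambda>\<omega>. exp (- (((\<Sum>j\<in>T. c j * of_bool (\<omega> (f j))) + s)\<^sup>2 / 2))) \<le> q"
    using gaussian_small_ball_const_indexed[OF p] by blast
  define \<kappa> where "\<kappa> = - ln q / 8"
  have \<kappa>: "0 < \<kappa>" using q by (simp add: \<kappa>_def)
  have q\<kappa>: "q = exp (- (8 * \<kappa>))" using q by (simp add: \<kappa>_def)
  \<comment> \<open>Chosen so that the tolerance factor
    \<open>exp (L * \<rho>\<^sup>2 * n / 2)\<close> is at most exp (\<kappa> n).\<close>
  define \<rho> where "\<rho> = min (1 / 2) (\<kappa> / (L + 1))"
  have \<rho>: "0 < \<rho>" using \<kappa> L by (simp add: \<rho>_def)
  have \<rho>_le: "\<rho> \<le> 1 / 2" unfolding \<rho>_def by (rule min.cobounded1)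
  have L\<rho>: "L * \<rho>\<^sup>2 / 2 \<le> \<kappa>"
  proof -
    have "\<rho>\<^sup>2 / 2 \<le> \<rho>" using mult_left_mono[of \<rho> 2 \<rho>] \<rho> \<rho>_le by (simp add: power2_eq_square)
    from mult_left_mono[OF this L] have "L * \<rho>\<^sup>2 / 2 \<le> L * \<rho>" by simp
    also have "\<dots> \<le> (L + 1) * (\<kappa> / (L + 1))"
      using L \<rho> \<kappa> by (intro mult_mono) (auto simp: \<rho>_def)
    also have "\<dots> = \<kappa>" using L by simp
    finally show ?thesis .
  qed
  \<comment> \<open>In \<open>grid_card\<close> with \<open>s = 1\<close> the last factor becomes (1
    + \<kappa>)^n <= exp (\<kappa> n).\<close>
  define a where "a = 2 / \<kappa>"
  have a: "0 < a" using \<kappa> by (simp add: a_def)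
  \<comment> \<open>\<open>d\<close> is the square root of \<open>\<delta>\<close>; its smallness
    keeps the first factor of \<open>grid_card\<close> below exp (\<kappa> n).\<close>
  define d where "d = min (1 / 2) (\<rho> * \<kappa> / ln (1 + a))"
  have d: "0 < d" using \<rho> \<kappa> a by (simp add: d_def)
  have d_le: "d \<le> 1 / 2" unfolding d_def by (rule min.cobounded1)
  have d_ln: "d / \<rho> * ln (1 + a) \<le> \<kappa>"
  proof -
    have "d / \<rho> * ln (1 + a) \<le> (\<rho> * \<kappa> / ln (1 + a)) / \<rho> * ln (1 + a)"
      using \<rho> a by (intro mult_right_mono divide_right_mono) (auto simp: d_def)
    also have "\<dots> = \<kappa>" using \<rho> a by simp
    finally show ?thesis .
  qed
  define \<delta> where "\<delta> = d\<^sup>2"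
  have \<delta>: "0 < \<delta>" "\<delta> \<le> 1 / 2" "sqrt \<delta> = d"
  proof -
    have "d * d \<le> 1 / 2 * 1" using d d_le by (intro mult_mono) auto
    thus "\<delta> \<le> 1 / 2" by (simp add: \<delta>_def power2_eq_square)
  qed (use d in \<open>auto simp: \<delta>_def\<close>)
  define D where "D = 2 * M / \<rho> + 1"
  have D: "0 \<le> D" using M \<rho> by (simp add: D_def)
  have "measure_pmf.prob (coin_flips (vertex_pairs n) p)
       {\<omega>. bad_grid n p M L \<rho> (sparse_grid n \<delta> \<rho>) (edges_of n \<omega>)} \<le> D * exp (- \<kappa>) ^ n" for n
  proof -
    have fin: "finite (grid n (sqrt \<delta> / \<rho> * n) n)" using grid_card(1)[of 1 1] by simp
    have card: "real (card (sparse_grid n \<delta> \<rho>)) \<le> exp (2 * \<kappa> * n)"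
    proof -
      have "real (card (sparse_grid n \<delta> \<rho>)) \<le> real (card (grid n (sqrt \<delta> / \<rho> * n) n))"
        using fin by (intro of_nat_mono card_mono) (auto simp: sparse_grid_def)
      also have "\<dots> \<le> (1 + a) powr (sqrt \<delta> / \<rho> * n) * (1 / 1) powr n * (1 + 2 * 1 / a) ^ n"
        using a by (intro grid_card(2)) auto
      also have "\<dots> \<le> exp (n * \<kappa>) * 1 * exp (n * \<kappa>)"
      proof (intro mult_mono)
        have "(1 + a) powr (sqrt \<delta> / \<rho> * n) = exp (n * (d / \<rho> * ln (1 + a)))"
          using a \<delta> by (simp add: powr_def mult_ac)
        also have "\<dots> \<le> exp (n * \<kappa>)" using mult_left_mono[OF d_ln, of n] by simp
        finally show "(1 + a) powr (sqrt \<delta> / \<rho> * n) \<le> exp (n * \<kappa>)" .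
        have "1 + 2 * 1 / a \<le> exp \<kappa>" using \<kappa> exp_ge_add_one_self[of \<kappa>] by (simp add: a_def)
        hence "(1 + 2 * 1 / a) ^ n \<le> exp \<kappa> ^ n" using a by (intro power_mono) auto
        thus "(1 + 2 * 1 / a) ^ n \<le> exp (n * \<kappa>)" by (simp add: exp_of_nat_mult)
      qed (use a in auto)
      finally have "real (card (sparse_grid n \<delta> \<rho>)) \<le> exp (n * \<kappa>) * exp (n * \<kappa>)" by simp
      thus ?thesis by (simp add: mult_ac flip: exp_add)
    qed
    have near: "measure_pmf.prob (coin_flips (vertex_pairs n) p)
      {\<omega>. near_constant n p (edges_of n \<omega>) L \<rho> k t} \<le> exp (- 3 * \<kappa> * n)"
      if k: "k \<in> sparse_grid n \<delta> \<rho>" for k t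
    proof -
      let ?T = "grid_support n k"
      \<comment> \<open>The division by 1 is the instance \<open>\<sigma> = 1\<close> of
        \<open>prob_rows_small\<close>.\<close>
      have c1: "\<bar>\<rho> / sqrt n * k j / 1\<bar> \<le> 1" if "j \<in> ?T" for j
      proof -
        have "(\<rho> / sqrt n * k j)\<^sup>2 \<le> (\<Sum>i\<in>?T. (\<rho> / sqrt n * k i)\<^sup>2)"
          using that grid_support_subset finite_subset[OF grid_support_subset, of n k]
          by (intro member_le_sum) auto
        also have "\<dots> \<le> 1" using k by (simp add: sparse_grid_def)
        finally show ?thesis by (simp add: abs_square_le_1)
      qed
      have "measure_pmf.prob (coin_flips (vertex_pairs n) p)
          {\<omega>. near_constant n p (edges_of n \<omega>) L \<rho> k t} \<le>
        exp (L * \<rho>\<^sup>2 * n / (2 * 1\<^sup>2)) * q ^ (n - card ?T)"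
        unfolding near_constant_def
      proof (rule prob_rows_small[OF grid_support_subset])
        fix i s assume i: "i \<in> {..<n} - ?T"
        show "measure_pmf.expectation (coin_flips (vertex_pairs n) p)
            (\<lambda>\<omega>. exp (- (((\<Sum>j\<in>?T. \<rho> / sqrt n * k j / 1 * of_bool (\<omega> {i, j})) + s)\<^sup>2 / 2))) \<le> q"
        proof (rule small_ball)
          show "(\<lambda>j. {i, j}) ` ?T \<subseteq> vertex_pairs n"
            using i by (auto simp: pair_in_vertex_pairs_iff grid_support_def)
          show "inj_on (\<lambda>j. {i, j}) ?T" by (auto simp: inj_on_def doubleton_eq_iff)
          show "1 / 4 \<le> (\<Sum>j\<in>?T. (\<rho> / sqrt n * k j / 1)\<^sup>2)" using k by (simp add: sparse_grid_def)
        qed (use c1 in auto)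
      qed simp
      also have "\<dots> \<le> exp (\<kappa> * n) * exp (- (4 * \<kappa> * n))"
      proof (intro mult_mono)
        show "exp (L * \<rho>\<^sup>2 * n / (2 * 1\<^sup>2)) \<le> exp (\<kappa> * n)"
          using mult_right_mono[OF L\<rho>, of n] by simp
        have "card ?T \<le> n" using card_mono[OF _ grid_support_subset, of n k] by simp
        moreover have "real (card ?T) \<le> n / 2"
        proof -
          have "\<delta> * n \<le> 1 / 2 * n" using \<delta> by (intro mult_right_mono) auto
          thus ?thesis using k by (simp add: sparse_grid_def)
        qed
        ultimately have "n / 2 \<le> real (n - card ?T)" by (simp add: of_nat_diff)
        hence "8 * \<kappa> * (n / 2) \<le> 8 * \<kappa> * real (n - card ?T)"
          using \<kappa> by (intro mult_left_mono) auto
        moreover have "q ^ (n - card ?T) = exp (- (8 * \<kappa> * real (n - card ?T)))"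
          unfolding q\<kappa> by (simp add: mult_ac flip: exp_of_nat_mult)
        ultimately show "q ^ (n - card ?T) \<le> exp (- (4 * \<kappa> * n))" by simp
      qed (use q in auto)
      finally show ?thesis by (simp add: mult.assoc flip: exp_add)
    qed
    have "measure_pmf.prob (coin_flips (vertex_pairs n) p)
       {\<omega>. bad_grid n p M L \<rho> (sparse_grid n \<delta> \<rho>) (edges_of n \<omega>)} \<le>
       real (card (sparse_grid n \<delta> \<rho>)) * (D * exp (- 3 * \<kappa> * n))"
      unfolding D_def
      by (rule prob_bad_grid_le[OF \<rho> M _ _ near]) (use fin in \<open>auto simp: sparse_grid_def\<close>)
    also have "\<dots> \<le> exp (2 * \<kappa> * n) * (D * exp (- 3 * \<kappa> * n))"
      using card D by (intro mult_right_mono) auto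
    also have "\<dots> = D * exp (n * (- \<kappa>))" by (simp flip: exp_add)
    also have "exp (n * (- \<kappa>)) = exp (- \<kappa>) ^ n" by (rule exp_of_nat_mult)
    finally show ?thesis .
  qed
  thus ?thesis using that[OF \<rho> \<rho>_le \<delta>(1) \<kappa>] by blast
qed

section \<open>Spread grid vectors\<close>

text \<open>\<open>B\<close> witnesses the spread: a positive fraction of the coordinates has exact
  order 1 / sqrt n. The constants are those that survive rounding at a mesh with
  \<open>\<epsilon> \<le> \<rho> / 2\<close>.\<close>

definition spread_grid :: "nat \<Rightarrow> real \<Rightarrow> real \<Rightarrow> real \<Rightarrow> real \<Rightarrow> (nat \<Rightarrow> int) set" where
  "spread_grid n \<eta> \<delta> \<rho> \<epsilon> = {k \<in> grid n (n / \<epsilon>) ((1 / 2 - \<eta>) * n).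
     \<exists>B\<subseteq>grid_support n k. \<delta> / 2 * n \<le> real (card B) \<and>
       (\<forall>j\<in>B. \<rho> / (2 * sqrt n) \<le> \<bar>\<epsilon> / sqrt n * k j\<bar> \<and> \<bar>\<epsilon> / sqrt n * k j\<bar> \<le> sqrt (2 / \<delta>) / sqrt n)}"

text \<open>Each of at least (1/2 + \<eta>) n rows has probability at most 2 C \<epsilon>, against
  at most a constant to the n times (2 / \<epsilon>) to the (1/2 - \<eta>) n grid vectors. The
  surplus power of \<epsilon> is 2 \<eta> n, so a small constant \<epsilon> wins.\<close>

lemma prob_bad_spread_grid:
  assumes p: "0 < p" "p < 1" and M: "0 \<le> M" and L: "0 \<le> L"
    and \<eta>: "0 < \<eta>" "\<eta> < 1 / 2" and \<rho>: "0 < \<rho>" and \<delta>: "0 < \<delta>"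
  obtains \<epsilon> D :: real and N :: nat where "0 < \<epsilon>" "\<epsilon> \<le> \<rho> / 2"
    "\<And>n. N \<le> n \<Longrightarrow> measure_pmf.prob (coin_flips (vertex_pairs n) p)
       {\<omega>. bad_grid n p M L \<epsilon> (spread_grid n \<eta> \<delta> \<rho> \<epsilon>) (edges_of n \<omega>)} \<le> D * (1 / 2) ^ n"
proof -
  \<comment> \<open>With \<open>\<beta> = \<delta> * \<rho>\<^sup>2 / (8 *
    \<epsilon>\<^sup>2)\<close> the main term of the spread small ball bound equals
    \<open>C * \<epsilon>\<close>.\<close>
  define C where "C = 4 / (\<rho> * sqrt (p * (1 - p) * \<delta>))"
  have C: "0 < C" using p \<rho> \<delta> by (simp add: C_def)
  \<comment> \<open>Collects the factors free of \<open>\<epsilon>\<close> in the product of the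
    grid count and the row probabilities, per unit of \<open>n\<close>.\<close>
  define D' where "D' = exp 1 * 2 powr (1 / 2 - \<eta>) * 2 * exp (L / 2) * (2 * C) powr (1 / 2 + \<eta>)"
  have D': "0 < D'" using C by (simp add: D'_def)
  \<comment> \<open>In order, the bounds keep spread coordinates large after rounding, make
    \<open>2 * C * \<epsilon>\<close> at most 1, allow the weight \<open>\<epsilon> / 2\<close> in
    \<open>grid_card\<close>, and make the final base at most 1/2.\<close>
  define \<epsilon> where "\<epsilon> = min (\<rho> / 2) (min (1 / (2 * C)) (min 1 ((1 / (2 * D')) powr (1 / (2 * \<eta>)))))"
  have \<epsilon>0: "0 < \<epsilon>" using \<rho> C D' by (simp add: \<epsilon>_def)
  have \<epsilon>: "\<epsilon> \<le> \<rho> / 2" "\<epsilon> \<le> 1 / (2 * C)" "\<epsilon> \<le> 1" "\<epsilon> \<le> (1 / (2 * D')) powr (1 / (2 * \<eta>))"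
    unfolding \<epsilon>_def by (meson min.cobounded1 min.cobounded2 order_trans)+
  have C\<epsilon>: "2 * C * \<epsilon> \<le> 1" "0 < 2 * C * \<epsilon>" using \<epsilon>(2) C \<epsilon>0 by (auto simp: field_simps)
  have D'\<epsilon>: "D' * \<epsilon> powr (2 * \<eta>) \<le> 1 / 2"
  proof -
    have "\<epsilon> powr (2 * \<eta>) \<le> ((1 / (2 * D')) powr (1 / (2 * \<eta>))) powr (2 * \<eta>)"
      using \<epsilon>(4) \<epsilon>0 \<eta> by (intro powr_mono2) auto
    also have "\<dots> = 1 / (2 * D')" using \<eta> D' by (simp add: powr_powr)
    finally have "D' * \<epsilon> powr (2 * \<eta>) \<le> D' * (1 / (2 * D'))" using D' by (intro mult_left_mono) auto
    thus ?thesis using D' by simp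
  qed
  define D where "D = 2 * M / \<epsilon> + 1"
  have D: "0 \<le> D" using M \<epsilon>0 by (simp add: D_def)
  \<comment> \<open>From \<open>N\<close> on, the second term \<open>r\<^sup>2\<close> of the spread
    small ball bound is also at most \<open>C * \<epsilon>\<close>.\<close>
  define N where "N = nat \<lceil>2 / (\<delta> * C * \<epsilon> ^ 3)\<rceil> + 1"
  have "measure_pmf.prob (coin_flips (vertex_pairs n) p)
       {\<omega>. bad_grid n p M L \<epsilon> (spread_grid n \<eta> \<delta> \<rho> \<epsilon>) (edges_of n \<omega>)} \<le> D * (1 / 2) ^ n"
    if n: "N \<le> n" for n
  proof -
    have n0: "0 < n" using n by (simp add: N_def)
    have "2 / (\<delta> * C * \<epsilon> ^ 3) \<le> real n" using n unfolding N_def by linarith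
    hence n_large: "2 / (\<delta> * \<epsilon>\<^sup>2 * n) \<le> C * \<epsilon>"
      using \<delta> C \<epsilon>0 n0 by (simp add: field_simps power2_eq_square power3_eq_cube)
    have fin: "finite (grid n (n / \<epsilon>) ((1 / 2 - \<eta>) * n))" using grid_card(1)[of 1 1] by simp
    have card: "real (card (spread_grid n \<eta> \<delta> \<rho> \<epsilon>)) \<le> (exp 1 * (2 / \<epsilon>) powr (1 / 2 - \<eta>) * 2) ^ n"
    proof -
      have "real (card (spread_grid n \<eta> \<delta> \<rho> \<epsilon>)) \<le> real (card (grid n (n / \<epsilon>) ((1 / 2 - \<eta>) * n)))"
        using fin by (intro of_nat_mono card_mono) (auto simp: spread_grid_def)
      \<comment> \<open>\<open>grid_card\<close> with \<open>a = \<epsilon>\<close> and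
        \<open>s = \<epsilon> / 2\<close>: the first factor is at most e^n and the last one is 2^n,
        so \<open>\<epsilon>\<close> enters only through the support size.\<close>
      also have "\<dots> \<le> (1 + \<epsilon>) powr (n / \<epsilon>) * (1 / (\<epsilon> / 2)) powr ((1 / 2 - \<eta>) * n) * (1 + 2 * (\<epsilon> / 2) / \<epsilon>) ^ n"
        using \<epsilon>0 \<epsilon>(3) by (intro grid_card(2)) auto
      also have "(1 + \<epsilon>) powr (n / \<epsilon>) \<le> exp (real n * 1)"
      proof -
        have "n / \<epsilon> * ln (1 + \<epsilon>) \<le> n / \<epsilon> * \<epsilon>"
          using \<epsilon>0 by (intro mult_left_mono ln_add_one_self_le_self) auto
        thus ?thesis using \<epsilon>0 by (simp add: powr_def)
      qed
      also have "exp (real n * 1) = exp 1 ^ n" by (rule exp_of_nat_mult)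
      also have "(1 / (\<epsilon> / 2)) powr ((1 / 2 - \<eta>) * n) = ((2 / \<epsilon>) powr (1 / 2 - \<eta>)) ^ n"
        using \<epsilon>0 by (simp add: powr_power mult.commute)
      also have "1 + 2 * (\<epsilon> / 2) / \<epsilon> = 2" using \<epsilon>0 by simp
      finally show ?thesis
        using \<epsilon>0 by (simp add: power_mult_distrib mult_right_mono)
    qed
    have near: "measure_pmf.prob (coin_flips (vertex_pairs n) p)
      {\<omega>. near_constant n p (edges_of n \<omega>) L \<epsilon> k t} \<le> (exp (L / 2) * (2 * C * \<epsilon>) powr (1 / 2 + \<eta>)) ^ n"
      if k: "k \<in> spread_grid n \<eta> \<delta> \<rho> \<epsilon>" for k t
    proof -
      let ?T = "grid_support n k"
      obtain B where B: "B \<subseteq> ?T" "\<delta> / 2 * n \<le> real (card B)"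
        "\<And>j. j \<in> B \<Longrightarrow> \<rho> / (2 * sqrt n) \<le> \<bar>\<epsilon> / sqrt n * k j\<bar>"
        "\<And>j. j \<in> B \<Longrightarrow> \<bar>\<epsilon> / sqrt n * k j\<bar> \<le> sqrt (2 / \<delta>) / sqrt n"
        using k by (auto simp: spread_grid_def)
      \<comment> \<open>At least \<open>\<delta> / 2 * n\<close> coordinates, each contributing at
        least the square of \<open>\<rho> / (2 * sqrt n) / \<epsilon>\<close>.\<close>
      define \<beta> where "\<beta> = \<delta> * \<rho>\<^sup>2 / (8 * \<epsilon>\<^sup>2)"
      have \<beta>: "0 < \<beta>" using \<delta> \<rho> \<epsilon>0 by (simp add: \<beta>_def)
      define r where "r = sqrt (2 / \<delta>) / sqrt n / \<epsilon>"
      have "measure_pmf.prob (coin_flips (vertex_pairs n) p)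
          {\<omega>. near_constant n p (edges_of n \<omega>) L \<epsilon> k t} \<le>
        exp (L * \<epsilon>\<^sup>2 * n / (2 * \<epsilon>\<^sup>2)) * (2 * C * \<epsilon>) ^ (n - card ?T)"
        unfolding near_constant_def
      proof (rule prob_rows_small[OF grid_support_subset \<epsilon>0])
        fix i s assume i: "i \<in> {..<n} - ?T"
        have "measure_pmf.expectation (coin_flips (vertex_pairs n) p)
            (\<lambda>\<omega>. exp (- (((\<Sum>j\<in>?T. \<epsilon> / sqrt n * k j / \<epsilon> * of_bool (\<omega> {i, j})) + s)\<^sup>2 / 2)))
            \<le> sqrt (2 / (p * (1 - p) * \<beta>)) + r\<^sup>2"
        proof (rule gaussian_small_ball_spread_indexed[OF _ _ _ p B(1) _ _ \<beta>])
          show "(\<lambda>j. {i, j}) ` ?T \<subseteq> vertex_pairs n"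
            using i by (auto simp: pair_in_vertex_pairs_iff grid_support_def)
          show "inj_on (\<lambda>j. {i, j}) ?T" by (auto simp: inj_on_def doubleton_eq_iff)
          show "0 < r" using \<delta> \<epsilon>0 n0 by (simp add: r_def)
          show "\<bar>\<epsilon> / sqrt n * k j / \<epsilon>\<bar> \<le> r" if "j \<in> B" for j
            using divide_right_mono[OF B(4)[OF that], of \<epsilon>] \<epsilon>0 unfolding r_def abs_divide by simp
          have "\<beta> = \<delta> / 2 * n * (\<rho> / (2 * sqrt n) / \<epsilon>)\<^sup>2"
            using n0 by (simp add: \<beta>_def power_mult_distrib power_divide)
          also have "\<dots> \<le> real (card B) * (\<rho> / (2 * sqrt n) / \<epsilon>)\<^sup>2"
            using B(2) by (intro mult_right_mono) auto
          also have "\<dots> = (\<Sum>j\<in>B. (\<rho> / (2 * sqrt n) / \<epsilon>)\<^sup>2)" by simp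
          also have "\<dots> \<le> (\<Sum>j\<in>B. (\<epsilon> / sqrt n * k j / \<epsilon>)\<^sup>2)"
          proof (intro sum_mono)
            fix j assume j: "j \<in> B"
            have "\<bar>\<rho> / (2 * sqrt n) / \<epsilon>\<bar> \<le> \<bar>\<epsilon> / sqrt n * k j / \<epsilon>\<bar>"
              using divide_right_mono[OF B(3)[OF j], of \<epsilon>] \<rho> \<epsilon>0
              unfolding abs_divide[of _ \<epsilon>] by simp
            thus "(\<rho> / (2 * sqrt n) / \<epsilon>)\<^sup>2 \<le> (\<epsilon> / sqrt n * k j / \<epsilon>)\<^sup>2"
              by (simp only: abs_le_square_iff)
          qed
          finally show "\<beta> \<le> (\<Sum>j\<in>B. (\<epsilon> / sqrt n * k j / \<epsilon>)\<^sup>2)" .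
        qed simp
        also have "sqrt (2 / (p * (1 - p) * \<beta>)) = C * \<epsilon>"
        proof -
          have "2 / (p * (1 - p) * \<beta>) = (C * \<epsilon>)\<^sup>2"
            using p \<delta> \<rho> \<epsilon>0 by (simp add: C_def \<beta>_def power_mult_distrib power_divide)
          thus ?thesis using C \<epsilon>0 by simp
        qed
        also have "r\<^sup>2 = 2 / (\<delta> * \<epsilon>\<^sup>2 * n)"
          using \<delta> n0 by (simp add: r_def power_divide power_mult_distrib mult_ac)
        finally show "measure_pmf.expectation (coin_flips (vertex_pairs n) p)
            (\<lambda>\<omega>. exp (- (((\<Sum>j\<in>?T. \<epsilon> / sqrt n * k j / \<epsilon> * of_bool (\<omega> {i, j})) + s)\<^sup>2 / 2))) \<le> 2 * C * \<epsilon>"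
          using n_large by linarith
      qed
      also have "\<dots> \<le> exp (real n * (L / 2)) * (2 * C * \<epsilon>) powr ((1 / 2 + \<eta>) * n)"
      proof (intro mult_mono)
        show "exp (L * \<epsilon>\<^sup>2 * n / (2 * \<epsilon>\<^sup>2)) \<le> exp (real n * (L / 2))"
          using \<epsilon>0 by simp
        have "card ?T \<le> n" using card_mono[OF _ grid_support_subset, of n k] by simp
        moreover have "real (card ?T) \<le> (1 / 2 - \<eta>) * n"
          using k by (simp add: spread_grid_def grid_def grid_support_def)
        ultimately have "(1 / 2 + \<eta>) * n \<le> real (n - card ?T)"
          by (simp add: of_nat_diff algebra_simps)
        moreover have "(2 * C * \<epsilon>) ^ (n - card ?T) = (2 * C * \<epsilon>) powr real (n - card ?T)"
          using C\<epsilon> by (simp add: powr_realpow)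
        ultimately show "(2 * C * \<epsilon>) ^ (n - card ?T) \<le> (2 * C * \<epsilon>) powr ((1 / 2 + \<eta>) * n)"
          using C\<epsilon> by (simp add: powr_mono')
      qed (use C\<epsilon> in auto)
      also have "exp (real n * (L / 2)) = exp (L / 2) ^ n" by (rule exp_of_nat_mult)
      also have "(2 * C * \<epsilon>) powr ((1 / 2 + \<eta>) * n) = ((2 * C * \<epsilon>) powr (1 / 2 + \<eta>)) ^ n"
        by (subst powr_powr[symmetric], rule powr_realpow) (use C \<epsilon>0 in simp)
      finally show ?thesis by (simp only: power_mult_distrib)
    qed
    have "measure_pmf.prob (coin_flips (vertex_pairs n) p)
       {\<omega>. bad_grid n p M L \<epsilon> (spread_grid n \<eta> \<delta> \<rho> \<epsilon>) (edges_of n \<omega>)} \<le>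
       real (card (spread_grid n \<eta> \<delta> \<rho> \<epsilon>)) * (D * (exp (L / 2) * (2 * C * \<epsilon>) powr (1 / 2 + \<eta>)) ^ n)"
      unfolding D_def
      by (rule prob_bad_grid_le[OF \<epsilon>0 M _ _ near]) (use fin in \<open>auto simp: spread_grid_def\<close>)
    also have "\<dots> \<le> (exp 1 * (2 / \<epsilon>) powr (1 / 2 - \<eta>) * 2) ^ n * (D * (exp (L / 2) * (2 * C * \<epsilon>) powr (1 / 2 + \<eta>)) ^ n)"
      using card D by (intro mult_right_mono) auto
    also have "\<dots> = D * ((exp 1 * (2 / \<epsilon>) powr (1 / 2 - \<eta>) * 2) * (exp (L / 2) * (2 * C * \<epsilon>) powr (1 / 2 + \<eta>))) ^ n"
      by (simp only: power_mult_distrib mult_ac)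
    also have "(exp 1 * (2 / \<epsilon>) powr (1 / 2 - \<eta>) * 2) * (exp (L / 2) * (2 * C * \<epsilon>) powr (1 / 2 + \<eta>))
        = D' * \<epsilon> powr (2 * \<eta>)"
    proof -
      have "(2 / \<epsilon>) powr (1 / 2 - \<eta>) = 2 powr (1 / 2 - \<eta>) / \<epsilon> powr (1 / 2 - \<eta>)"
        using \<epsilon>0 by (simp add: powr_divide)
      moreover have "(2 * C * \<epsilon>) powr (1 / 2 + \<eta>) = (2 * C) powr (1 / 2 + \<eta>) * \<epsilon> powr (1 / 2 + \<eta>)"
        using \<epsilon>0 C by (simp add: powr_mult)
      moreover have "\<epsilon> powr (1 / 2 + \<eta>) = \<epsilon> powr (1 / 2 - \<eta>) * \<epsilon> powr (2 * \<eta>)"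
        using powr_add[of \<epsilon> "1 / 2 - \<eta>" "2 * \<eta>"] by (simp add: add.commute)
      ultimately show ?thesis using \<epsilon>0 by (simp add: D'_def)
    qed
    also have "D * (D' * \<epsilon> powr (2 * \<eta>)) ^ n \<le> D * (1 / 2) ^ n"
      using D D' D'\<epsilon> by (intro mult_left_mono power_mono) auto
    finally show ?thesis .
  qed
  thus ?thesis using that[OF \<epsilon>0 \<epsilon>(1)] by blast
qed

section \<open>Eigenvectors of typical graphs\<close>

abbreviation adj :: "nat set set \<Rightarrow> nat \<Rightarrow> nat \<Rightarrow> real" where
  "adj E i j \<equiv> of_bool ({i, j} \<in> E)"

lemma degree_of_eq_sum: "real (degree_of n E i) = (\<Sum>j<n. adj E i j)"
  by (simp add: degree_of_def sum_of_bool_eq Int_def)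

lemma degree_of_le: "degree_of n E i \<le> n"
  unfolding degree_of_def using card_mono[of "{..<n}" "{j \<in> {..<n}. {i, j} \<in> E}"] by auto

text \<open>The degree vector is A applied to the constant vector 1, and A is symmetric.\<close>

lemma sum_degree_of_mult: "(\<Sum>i<n. real (degree_of n E i) * x i) = (\<Sum>i<n. \<Sum>j<n. adj E i j * x j)"
proof -
  have "(\<Sum>i<n. \<Sum>j<n. adj E i j * x j) = (\<Sum>j<n. \<Sum>i<n. adj E j i * x j)"
    by (subst sum.swap) (simp add: insert_commute)
  thus ?thesis by (simp add: degree_of_eq_sum sum_distrib_right)
qed

text \<open>The substitution \<open>x = D\<^sup>-\<^sup>1\<^sup>/\<^sup>2 v\<close> turns the
  eigenvalue equation into A x = (1 - \<nu>) D x; positive degrees make it invertible.\<close>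

lemma normalized_laplacian_eigenvector:
  assumes ev: "eigenvector (normalized_laplacian n E) v \<nu>"
    and deg: "\<And>i. i < n \<Longrightarrow> 0 < degree_of n E i" and i: "i < n"
  defines "x \<equiv> \<lambda>i. v $ i / sqrt (degree_of n E i)"
  shows "(\<Sum>j<n. adj E i j * x j) = (1 - \<nu>) * degree_of n E i * x i"
proof -
  let ?d = "\<lambda>i. real (degree_of n E i)"
  have A: "degree_mat n E - adjacency_mat n E \<in> carrier_mat n n"
    by (auto simp: degree_mat_def adjacency_mat_def mat_diag_def)
  have L: "normalized_laplacian n E =
     mat n n (\<lambda>(i, j). 1 / sqrt (?d i) * (of_bool (i = j) * ?d j - adj E i j) * (1 / sqrt (?d j)))"
    unfolding normalized_laplacian_def inv_sqrt_degree_mat_def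
    by (subst mat_diag_mult_left[OF A], subst mat_diag_mult_right[of _ n n])
      (auto simp: degree_mat_def adjacency_mat_def mat_diag_def)
  have dim: "dim_vec v = n" using ev by (auto simp: eigenvector_def L)
  have "(normalized_laplacian n E *\<^sub>v v) $ i = (\<nu> \<cdot>\<^sub>v v) $ i"
    using ev by (simp add: eigenvector_def)
  hence "(\<Sum>j<n. 1 / sqrt (?d i) * (of_bool (i = j) * ?d j - adj E i j) * (1 / sqrt (?d j)) * v $ j) = \<nu> * v $ i"
    using i dim by (simp add: L scalar_prod_def atLeast0LessThan)
  hence "sqrt (?d i) * (\<Sum>j<n. 1 / sqrt (?d i) * (of_bool (i = j) * ?d j - adj E i j) * (1 / sqrt (?d j)) * v $ j)
     = sqrt (?d i) * (\<nu> * v $ i)" by simp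
  moreover have "sqrt (?d i) * (\<Sum>j<n. 1 / sqrt (?d i) * (of_bool (i = j) * ?d j - adj E i j) * (1 / sqrt (?d j)) * v $ j)
     = (\<Sum>j<n. of_bool (i = j) * ?d j * x j - adj E i j * x j)"
    using deg[OF i] unfolding sum_distrib_left
    by (intro sum.cong refl) (simp add: x_def left_diff_distrib right_diff_distrib diff_divide_distrib)
  moreover have "(\<Sum>j<n. of_bool (i = j) * ?d j * x j - adj E i j * x j) = ?d i * x i - (\<Sum>j<n. adj E i j * x j)"
    using i by (simp add: sum_subtractf sum.delta if_distrib[of "\<lambda>b. b * _"] of_bool_def cong: if_cong)
  moreover have "sqrt (?d i) * (\<nu> * v $ i) = \<nu> * ?d i * x i"
    using deg[OF i] by (simp add: x_def field_simps)
  ultimately have "(\<Sum>j<n. adj E i j * x j) = ?d i * x i - \<nu> * ?d i * x i" by linarith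
  thus ?thesis by (simp only: left_diff_distrib mult_1_left)
qed

section \<open>Deterministic estimates for typical graphs\<close>

text \<open>The constant in \<bar>\<mu>\<bar> <= \<open>eig_const p\<close> / sqrt n, obtained from
  \<open>eigenvalue_bound\<close> by estimating \<open>121 / p\<close> by
  \<open>121 / p * sqrt n\<close>.\<close>

definition eig_const :: "real \<Rightarrow> real" where
  "eig_const p = 2 * (11 + 121 / p) / p"

text \<open>Collects two graph properties that fail with exponentially small probability; the
  results derived from them are deterministic.\<close>

locale typical_graph =
  fixes n :: nat and p :: real and E :: "nat set set"
  assumes n: "0 < n" and p: "0 < p" "p < 1"
    and quad: "quad_bounded n p E"
    and deg: "\<And>i. i < n \<Longrightarrow> n * p / 2 \<le> degree_of n E i"
begin

lemma norm_centered_adj: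
  fixes y :: "nat \<Rightarrow> real"
  shows "(\<Sum>i<n. (\<Sum>j<n. centered_adj p E i j * y j)\<^sup>2) \<le> 121 * n * (\<Sum>i<n. (y i)\<^sup>2)"
proof -
  have "(\<Sum>i<n. (\<Sum>j<n. centered_adj p E i j * y j)\<^sup>2) \<le> (11 * sqrt n)\<^sup>2 * (\<Sum>i<n. (y i)\<^sup>2)"
    using quad n by (intro matrix_norm_le_of_quad centered_adj_sym) (auto simp: quad_bounded_def)
  thus ?thesis by (simp add: power_mult_distrib)
qed

text \<open>A vector orthogonal to the degrees is almost orthogonal to the constants, because the
  degrees deviate from \<open>n p\<close> by the row sums of the centred adjacency matrix.\<close>

lemma mean_bound:
  fixes y :: "nat \<Rightarrow> real"
  assumes orth: "(\<Sum>i<n. degree_of n E i * y i) = 0"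
  shows "(p * (\<Sum>i<n. y i))\<^sup>2 \<le> 121 * (\<Sum>i<n. (y i)\<^sup>2)"
proof -
  define w where "w i = (\<Sum>j<n. centered_adj p E i j * 1)" for i
  have w: "w i = degree_of n E i - n * p" for i
    by (simp add: w_def centered_adj_def sum_subtractf degree_of_eq_sum)
  have "(\<Sum>i<n. y i * w i) = (\<Sum>i<n. degree_of n E i * y i) - n * p * (\<Sum>i<n. y i)"
    by (simp add: w algebra_simps sum_subtractf sum_distrib_left)
  hence "n * p * (\<Sum>i<n. y i) = - (\<Sum>i<n. y i * w i)" using orth by simp
  hence "(n * p * (\<Sum>i<n. y i))\<^sup>2 = (\<Sum>i<n. y i * w i)\<^sup>2" by simp
  also have "\<dots> \<le> (\<Sum>i<n. (y i)\<^sup>2) * (\<Sum>i<n. (w i)\<^sup>2)"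
    by (rule Cauchy_Schwarz_ineq_sum)
  also have "\<dots> \<le> (\<Sum>i<n. (y i)\<^sup>2) * (121 * n * n)"
    using norm_centered_adj[of "\<lambda>_. 1"] by (intro mult_left_mono) (auto simp: w_def sum_nonneg)
  finally have "(real n)\<^sup>2 * (p * (\<Sum>i<n. y i))\<^sup>2 \<le> (real n)\<^sup>2 * (121 * (\<Sum>i<n. (y i)\<^sup>2))"
    by (simp add: power2_eq_square mult_ac)
  thus ?thesis using n by simp
qed

text \<open>Compare both sides of y^T A y = \<mu> y^T D y, with A = W + p J: the form of W is
  bounded by \<open>quad_bounded\<close>, that of p J by \<open>mean_bound\<close>, and the degrees
  from below. The sum of squares is not divided out, so that \<open>y\<close> may vanish.\<close>

lemma eigenvalue_bound:
  fixes y :: "nat \<Rightarrow> real" and \<mu> :: real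
  assumes orth: "(\<Sum>i<n. degree_of n E i * y i) = 0"
    and eig: "\<And>i. i < n \<Longrightarrow> (\<Sum>j<n. adj E i j * y j) = \<mu> * degree_of n E i * y i"
  shows "\<bar>\<mu>\<bar> * (n * p / 2) * (\<Sum>i<n. (y i)\<^sup>2) \<le> (11 * sqrt n + 121 / p) * (\<Sum>i<n. (y i)\<^sup>2)"
proof -
  let ?Q = "\<Sum>i<n. (y i)\<^sup>2"
  let ?s = "\<Sum>i<n. y i"
  have "\<bar>\<mu>\<bar> * (n * p / 2) * ?Q = \<bar>\<mu>\<bar> * (\<Sum>i<n. n * p / 2 * (y i)\<^sup>2)"
    by (simp add: sum_distrib_left mult_ac)
  also have "\<dots> \<le> \<bar>\<mu>\<bar> * (\<Sum>i<n. degree_of n E i * (y i)\<^sup>2)"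
    using deg by (intro mult_left_mono sum_mono mult_right_mono) auto
  also have "\<dots> = \<bar>\<mu> * (\<Sum>i<n. degree_of n E i * (y i)\<^sup>2)\<bar>"
    by (simp add: abs_mult sum_nonneg)
  also have "\<mu> * (\<Sum>i<n. degree_of n E i * (y i)\<^sup>2) = (\<Sum>i<n. y i * (\<Sum>j<n. adj E i j * y j))"
    unfolding sum_distrib_left[of \<mu>]
  proof (intro sum.cong refl)
    fix i assume "i \<in> {..<n}"
    hence i: "i < n" by simp
    show "\<mu> * (degree_of n E i * (y i)\<^sup>2) = y i * (\<Sum>j<n. adj E i j * y j)"
      unfolding eig[OF i] by (simp add: power2_eq_square mult_ac)
  qed
  also have "\<dots> = (\<Sum>i<n. y i * (\<Sum>j<n. centered_adj p E i j * y j + p * y j))"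
    by (simp add: centered_adj_def algebra_simps)
  also have "\<dots> = bilin n (centered_adj p E) y y + (\<Sum>i<n. y i * (p * ?s))"
    by (simp add: bilin_def sum.distrib sum_distrib_left distrib_left mult_ac)
  also have "(\<Sum>i<n. y i * (p * ?s)) = (p * ?s)\<^sup>2 / p"
    using p by (simp add: power2_eq_square flip: sum_distrib_right)
  also have "\<bar>bilin n (centered_adj p E) y y + (p * ?s)\<^sup>2 / p\<bar> \<le> 11 * sqrt n * ?Q + 121 * ?Q / p"
  proof -
    have "(p * ?s)\<^sup>2 / p \<le> 121 * ?Q / p"
      using mean_bound[OF orth] p by (intro divide_right_mono) auto
    moreover have "\<bar>bilin n (centered_adj p E) y y\<bar> \<le> 11 * sqrt n * ?Q"
      using quad by (simp add: quad_bounded_def)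
    moreover have "0 \<le> (p * ?s)\<^sup>2 / p" using p by simp
    ultimately show ?thesis by linarith
  qed
  finally show ?thesis by (simp add: algebra_simps)
qed

text \<open>With t = p times the sum of \<open>y\<close>, the equation reads W y + t 1 = \<mu> D y.
  Off the support of the rounded vector its image plus \<tau> l differs from 0 by three errors:
  \<mu> D y, which is O(\<tau>) since \<open>y\<close> is below the mesh there; W applied to the
  rounding error; and the rounding of t. They account for \<open>(eig_const p)\<^sup>2\<close>, 121
  and 1.\<close>

lemma near_constant_round:
  fixes y :: "nat \<Rightarrow> real" and \<mu> \<tau> :: real
  assumes orth: "(\<Sum>i<n. degree_of n E i * y i) = 0"
    and eig: "\<And>i. i < n \<Longrightarrow> (\<Sum>j<n. adj E i j * y j) = \<mu> * degree_of n E i * y i"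
    and unit: "(\<Sum>i<n. (y i)\<^sup>2) = 1" and \<tau>: "0 < \<tau>"
  obtains l :: int where "\<bar>\<tau> * l\<bar> \<le> 11"
    "near_constant n p E (3 * ((eig_const p)\<^sup>2 + 122)) \<tau> (round_to_grid n (\<tau> / sqrt n) y) (\<tau> * l)"
proof -
  define h where "h = \<tau> / sqrt n"
  have h: "0 < h" using \<tau> n by (simp add: h_def)
  define k where "k = round_to_grid n h y"
  define T where "T = grid_support n k"
  define t where "t = p * (\<Sum>i<n. y i)"
  define l where "l = toward_zero (t / \<tau>)"
  have "t\<^sup>2 \<le> 11\<^sup>2" using mean_bound[OF orth] by (simp add: t_def unit)
  hence t: "\<bar>t\<bar> \<le> 11" by (metis abs_le_square_iff abs_numeral)
  have "\<bar>\<tau> * l\<bar> = \<tau> * \<bar>real_of_int l\<bar>" using \<tau> by (simp add: abs_mult)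
  also have "\<dots> \<le> \<tau> * \<bar>t / \<tau>\<bar>"
    unfolding l_def using \<tau> by (intro mult_left_mono abs_toward_zero_le) auto
  also have "\<dots> = \<bar>t\<bar>" using \<tau> by (simp add: abs_divide)
  finally have l: "\<bar>\<tau> * l\<bar> \<le> 11" using t by simp
  have "\<bar>t - \<tau> * l\<bar> = \<tau> * \<bar>t / \<tau> - l\<bar>"
  proof -
    have "t - \<tau> * l = \<tau> * (t / \<tau> - l)" using \<tau> by (simp add: right_diff_distrib)
    thus ?thesis using \<tau> by (simp only: abs_mult abs_of_pos)
  qed
  also have "\<dots> \<le> \<tau> * 1" unfolding l_def using toward_zero_error \<tau> by (intro mult_left_mono) auto
  finally have tl: "(t - \<tau> * l)\<^sup>2 \<le> \<tau>\<^sup>2" using \<tau> by (simp add: power2_le_iff_abs_le)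
  define z where "z j = y j - h * k j" for j
  have z: "(\<Sum>i<n. (z i)\<^sup>2) \<le> \<tau>\<^sup>2"
  proof -
    have "(\<Sum>i<n. (z i)\<^sup>2) \<le> (\<Sum>i<n. h\<^sup>2)"
      using round_to_grid(2)[OF h, of _ n y] h
      by (intro sum_mono) (simp add: z_def k_def power2_le_iff_abs_le)
    also have "\<dots> = \<tau>\<^sup>2" using n by (simp add: h_def power_divide)
    finally show ?thesis .
  qed
  have \<mu>: "\<bar>\<mu>\<bar> * n \<le> eig_const p * sqrt n"
  proof -
    have "\<bar>\<mu>\<bar> * (n * p / 2) \<le> 11 * sqrt n + 121 / p"
      using eigenvalue_bound[OF orth eig] unit by simp
    also have "\<dots> \<le> 11 * sqrt n + 121 / p * sqrt n"
    proof -
      have "1 \<le> sqrt n" using n by simp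
      hence "121 / p * 1 \<le> 121 / p * sqrt n" using p by (intro mult_left_mono) auto
      thus ?thesis by simp
    qed
    finally have le: "\<bar>\<mu>\<bar> * (n * p / 2) \<le> 11 * sqrt n + 121 / p * sqrt n" .
    have "\<bar>\<mu>\<bar> * n = 2 / p * (\<bar>\<mu>\<bar> * (n * p / 2))" using p by simp
    also have "\<dots> \<le> 2 / p * (11 * sqrt n + 121 / p * sqrt n)"
      using p by (intro mult_left_mono le) auto
    also have "\<dots> = eig_const p * sqrt n"
      by (simp add: eig_const_def distrib_left distrib_right add_divide_distrib)
    finally show ?thesis .
  qed
  let ?W = "\<lambda>i y. \<Sum>j<n. centered_adj p E i j * y j"
  have row: "((\<Sum>j\<in>T. centered_adj p E i j * (h * k j)) + \<tau> * l)\<^sup>2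
      \<le> 3 * ((eig_const p * \<tau>)\<^sup>2 + (?W i z)\<^sup>2 + \<tau>\<^sup>2)" if i: "i \<in> {..<n} - T" for i
  proof -
    have "(\<Sum>j\<in>T. centered_adj p E i j * (h * k j)) = ?W i (\<lambda>j. h * k j)"
      by (intro sum.mono_neutral_left) (auto simp: T_def grid_support_def)
    also have "\<dots> = ?W i y - ?W i z"
      by (simp add: z_def algebra_simps sum_subtractf)
    also have "?W i y = \<mu> * degree_of n E i * y i - t"
      using eig[of i] i by (simp add: centered_adj_def left_diff_distrib sum_subtractf t_def sum_distrib_left)
    finally have eq: "(\<Sum>j\<in>T. centered_adj p E i j * (h * k j)) + \<tau> * l =
      \<mu> * degree_of n E i * y i - ?W i z - (t - \<tau> * l)" by simp
    have "\<bar>y i\<bar> \<le> h"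
      using i round_to_grid(3)[OF h, of i n y] by (auto simp: T_def grid_support_def k_def)
    hence "\<bar>\<mu> * degree_of n E i * y i\<bar> \<le> \<bar>\<mu>\<bar> * n * h"
      unfolding abs_mult using degree_of_le[of n E i] by (intro mult_mono) auto
    also have "\<dots> \<le> eig_const p * sqrt n * h" using \<mu> h by (intro mult_right_mono) auto
    also have "\<dots> = eig_const p * \<tau>" using n by (simp add: h_def)
    finally have "(\<mu> * degree_of n E i * y i)\<^sup>2 \<le> (eig_const p * \<tau>)\<^sup>2"
      by (simp add: abs_le_square_iff[symmetric])
    moreover have "(a - b - c)\<^sup>2 \<le> 3 * (a\<^sup>2 + b\<^sup>2 + c\<^sup>2)" for a b c :: real
    proof -
      have "3 * (a\<^sup>2 + b\<^sup>2 + c\<^sup>2) - (a - b - c)\<^sup>2 = (a + b)\<^sup>2 + (a + c)\<^sup>2 + (b - c)\<^sup>2"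
        by (simp add: power2_eq_square algebra_simps)
      thus ?thesis by (metis add_nonneg_nonneg diff_ge_0_iff_ge zero_le_power2)
    qed
    ultimately show ?thesis unfolding eq using tl by (smt (verit, best))
  qed
  have "(\<Sum>i\<in>{..<n} - T. ((\<Sum>j\<in>T. centered_adj p E i j * (h * k j)) + \<tau> * l)\<^sup>2)
    \<le> (\<Sum>i\<in>{..<n} - T. 3 * ((eig_const p * \<tau>)\<^sup>2 + (?W i z)\<^sup>2 + \<tau>\<^sup>2))" by (intro sum_mono row)
  also have "\<dots> \<le> (\<Sum>i<n. 3 * ((eig_const p * \<tau>)\<^sup>2 + (?W i z)\<^sup>2 + \<tau>\<^sup>2))"
    by (intro sum_mono2) auto
  also have "\<dots> = 3 * (n * (eig_const p * \<tau>)\<^sup>2 + (\<Sum>i<n. (?W i z)\<^sup>2) + n * \<tau>\<^sup>2)"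
    by (simp add: sum.distrib flip: sum_distrib_left)
  also have "\<dots> \<le> 3 * (n * (eig_const p * \<tau>)\<^sup>2 + 121 * n * \<tau>\<^sup>2 + n * \<tau>\<^sup>2)"
  proof -
    have "121 * n * (\<Sum>i<n. (z i)\<^sup>2) \<le> 121 * n * \<tau>\<^sup>2" using z by (intro mult_left_mono) auto
    thus ?thesis using norm_centered_adj[of z] by simp
  qed
  also have "\<dots> = 3 * ((eig_const p)\<^sup>2 + 122) * \<tau>\<^sup>2 * n"
    by (simp add: power_mult_distrib algebra_simps)
  finally have "near_constant n p E (3 * ((eig_const p)\<^sup>2 + 122)) \<tau> k (\<tau> * l)"
    by (simp add: near_constant_def T_def h_def)
  with l show ?thesis using that by (simp add: k_def h_def)
qed

text \<open>A dichotomy on the number of coordinates above \<rho> / sqrt n. If there are few,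
  rounding at scale \<rho> gives a vector in \<open>sparse_grid\<close>; otherwise, if the claim
  fails, rounding at scale \<epsilon> gives one in \<open>spread_grid\<close>. Either vector is near
  constant by \<open>near_constant_round\<close>, contradicting the absence of bad grid
  vectors.\<close>

lemma card_large_coordinates:
  fixes y :: "nat \<Rightarrow> real" and \<mu> :: real
  assumes orth: "(\<Sum>i<n. degree_of n E i * y i) = 0"
    and eig: "\<And>i. i < n \<Longrightarrow> (\<Sum>j<n. adj E i j * y j) = \<mu> * degree_of n E i * y i"
    and unit: "(\<Sum>i<n. (y i)\<^sup>2) = 1"
    and \<rho>: "0 < \<rho>" "\<rho> \<le> 1 / 2" and \<delta>: "0 < \<delta>" and \<epsilon>: "0 < \<epsilon>" "\<epsilon> \<le> \<rho> / 2"
    and sparse: "\<not> bad_grid n p 11 (3 * ((eig_const p)\<^sup>2 + 122)) \<rho> (sparse_grid n \<delta> \<rho>) E"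
    and spread: "\<not> bad_grid n p 11 (3 * ((eig_const p)\<^sup>2 + 122)) \<epsilon> (spread_grid n \<eta> \<delta> \<rho> \<epsilon>) E"
  shows "(1 / 2 - \<eta>) * n \<le> card {i \<in> {..<n}. \<epsilon> / sqrt n \<le> \<bar>y i\<bar>}"
proof (rule ccontr)
  assume small: "\<not> ?thesis"
  let ?L = "3 * ((eig_const p)\<^sup>2 + 122)"
  define k where "k \<tau> = round_to_grid n (\<tau> / sqrt n) y" for \<tau>
  define T where "T \<tau> = {i \<in> {..<n}. \<tau> / sqrt n \<le> \<bar>y i\<bar>}" for \<tau>
  have h: "0 < \<tau> / sqrt n" if "0 < \<tau>" for \<tau> using that n by simp
  have supp: "grid_support n (k \<tau>) = T \<tau>" if "0 < \<tau>" for \<tau>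
    using round_to_grid(3)[OF h[OF that], of _ n y] by (auto simp: grid_support_def k_def T_def)
  have T: "T \<tau> \<subseteq> {..<n}" "finite (T \<tau>)" for \<tau> by (auto simp: T_def)
  have sum_k: "real_of_int (\<Sum>i<n. \<bar>k \<tau> i\<bar>) \<le> sqrt (card (T \<tau>)) / (\<tau> / sqrt n)" if "0 < \<tau>" for \<tau>
    unfolding k_def using h[OF that] T unit
    by (intro round_to_grid_sum_abs_le) (auto simp: T_def)
  have ext: "k \<tau> \<in> extensional {..<n}" for \<tau> by (simp add: k_def round_to_grid_def)
  have near: "k \<tau> \<notin> S" if "0 < \<tau>" "\<not> bad_grid n p 11 ?L \<tau> S E" for \<tau> S
    using near_constant_round[OF orth eig unit that(1)] that(2) unfolding bad_grid_def k_def by blast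
  show False
  proof (cases "card (T \<rho>) \<le> \<delta> * n")
    case True
    have "k \<rho> \<in> sparse_grid n \<delta> \<rho>"
    proof -
      have "real_of_int (\<Sum>i<n. \<bar>k \<rho> i\<bar>) \<le> sqrt (\<delta> * n) / (\<rho> / sqrt n)"
        using sum_k[OF \<rho>(1)] True h[OF \<rho>(1)]
        by (elim order_trans) (intro divide_right_mono, auto)
      also have "\<dots> = sqrt \<delta> / \<rho> * n" by (simp add: real_sqrt_mult)
      finally have "real_of_int (\<Sum>i<n. \<bar>k \<rho> i\<bar>) \<le> sqrt \<delta> / \<rho> * n" .
      moreover have "card {i \<in> {..<n}. k \<rho> i \<noteq> 0} \<le> card {..<n}" by (intro card_mono) auto
      ultimately have grid: "k \<rho> \<in> grid n (sqrt \<delta> / \<rho> * n) n"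
        using ext by (simp add: grid_def)
      define z where "z i = \<rho> / sqrt n * k \<rho> i" for i
      have z_le: "\<bar>z i\<bar> \<le> \<bar>y i\<bar>" "\<bar>y i - z i\<bar> \<le> \<rho> / sqrt n" if "i < n" for i
        using round_to_grid(1,2)[OF h[OF \<rho>(1)] that, of y] h[OF \<rho>(1)] \<rho>(1)
        by (simp_all add: z_def k_def abs_mult)
      have sum_z: "(\<Sum>i\<in>grid_support n (k \<rho>). (z i)\<^sup>2) = (\<Sum>i<n. (z i)\<^sup>2)"
        by (intro sum.mono_neutral_left) (auto simp: grid_support_def z_def)
      have "(\<Sum>i<n. (z i)\<^sup>2) \<le> (\<Sum>i<n. (y i)\<^sup>2)"
        using z_le(1) by (intro sum_mono) (simp add: abs_le_square_iff)
      hence z1: "(\<Sum>i<n. (z i)\<^sup>2) \<le> 1" using unit by simp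
      \<comment> \<open>Rounding moves the unit vector by at most \<open>\<rho> \<le> 1 / 2\<close>,
        hence the rounded vector has norm at least 1/2.\<close>
      have "1 = L2_set y {..<n}" by (simp add: L2_set_def unit)
      also have "\<dots> = L2_set (\<lambda>i. z i + (y i - z i)) {..<n}" by simp
      also have "\<dots> \<le> L2_set z {..<n} + L2_set (\<lambda>i. y i - z i) {..<n}" by (rule L2_set_triangle_ineq)
      also have "L2_set (\<lambda>i. y i - z i) {..<n} \<le> sqrt (\<Sum>i<n. (\<rho> / sqrt n)\<^sup>2)"
        unfolding L2_set_def using z_le(2) h[OF \<rho>(1)] \<rho>(1)
        by (intro real_sqrt_le_mono sum_mono) (simp only: power2_le_iff_abs_le less_imp_le lessThan_iff)
      also have "\<dots> = \<rho>" using \<rho> n by (simp add: power_divide)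
      finally have "1 / 2 \<le> L2_set z {..<n}" using \<rho> by simp
      hence "(1 / 2)\<^sup>2 \<le> (L2_set z {..<n})\<^sup>2" by (intro power_mono) auto
      hence "1 / 4 \<le> (\<Sum>i<n. (z i)\<^sup>2)" by (simp add: L2_set_def sum_nonneg power2_eq_square)
      thus ?thesis
        using grid z1 sum_z True supp[OF \<rho>(1)] by (simp add: sparse_grid_def z_def)
    qed
    thus False using near[OF \<rho>(1) sparse] by simp
  next
    case False
    \<comment> \<open>Removes the exceptionally large coordinates. By Chebyshev's inequality for the
      unit vector there are at most \<open>\<delta> / 2 * n\<close> of them, so more than half of
      \<open>\<delta> * n\<close> remain.\<close>
    define B where "B = {i \<in> T \<rho>. \<bar>y i\<bar> \<le> sqrt (2 / \<delta>) / sqrt n}"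
    have "k \<epsilon> \<in> spread_grid n \<eta> \<delta> \<rho> \<epsilon>"
    proof -
      have "card (T \<epsilon>) \<le> n" using card_mono[OF _ T(1)] by simp
      hence "real_of_int (\<Sum>i<n. \<bar>k \<epsilon> i\<bar>) \<le> sqrt n / (\<epsilon> / sqrt n)"
        using sum_k[OF \<epsilon>(1)] h[OF \<epsilon>(1)]
        by (elim order_trans) (intro divide_right_mono, auto)
      also have "\<dots> = n / \<epsilon>" by simp
      finally have "real_of_int (\<Sum>i<n. \<bar>k \<epsilon> i\<bar>) \<le> n / \<epsilon>" .
      moreover have "card {i \<in> {..<n}. k \<epsilon> i \<noteq> 0} \<le> (1 / 2 - \<eta>) * n"
        using small supp[OF \<epsilon>(1)] by (simp add: T_def grid_support_def)
      ultimately have grid: "k \<epsilon> \<in> grid n (n / \<epsilon>) ((1 / 2 - \<eta>) * n)"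
        using ext by (simp add: grid_def)
      have "B \<subseteq> T \<epsilon>"
      proof
        fix i assume "i \<in> B"
        hence i: "i < n" "\<rho> / sqrt n \<le> \<bar>y i\<bar>" by (auto simp: B_def T_def)
        have "\<epsilon> / sqrt n \<le> \<rho> / sqrt n" using \<epsilon> by (intro divide_right_mono) auto
        thus "i \<in> T \<epsilon>" using i by (simp add: T_def)
      qed
      moreover have "\<delta> / 2 * n \<le> card B"
      proof -
        have finB: "finite B" using T by (simp add: B_def)
        have "card (T \<rho> - B) * (2 / \<delta> / n) = (\<Sum>i\<in>T \<rho> - B. (sqrt (2 / \<delta>) / sqrt n)\<^sup>2)"
          using \<delta> by (simp add: power_divide)
        also have "\<dots> \<le> (\<Sum>i\<in>T \<rho> - B. (y i)\<^sup>2)"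
        proof (intro sum_mono)
          fix i assume "i \<in> T \<rho> - B"
          hence "\<bar>sqrt (2 / \<delta>) / sqrt n\<bar> \<le> \<bar>y i\<bar>" using \<delta> by (auto simp: B_def)
          thus "(sqrt (2 / \<delta>) / sqrt n)\<^sup>2 \<le> (y i)\<^sup>2" by (simp only: abs_le_square_iff)
        qed
        also have "\<dots> \<le> (\<Sum>i<n. (y i)\<^sup>2)" using T by (intro sum_mono2) auto
        finally have "card (T \<rho> - B) \<le> \<delta> / 2 * n"
          using unit \<delta> n by (simp add: field_simps)
        moreover have "card (T \<rho>) = card (T \<rho> - B) + card B"
        proof -
          have "B \<subseteq> T \<rho>" by (auto simp: B_def)
          thus ?thesis using T(2)[of \<rho>] by (metis card_Diff_subset card_mono finite_subset le_add_diff_inverse2)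
        qed
        ultimately show ?thesis using False by simp
      qed
      moreover have "\<rho> / (2 * sqrt n) \<le> \<bar>\<epsilon> / sqrt n * k \<epsilon> j\<bar> \<and> \<bar>\<epsilon> / sqrt n * k \<epsilon> j\<bar> \<le> sqrt (2 / \<delta>) / sqrt n"
        if j: "j \<in> B" for j
      proof -
        have y: "j < n" "\<rho> / sqrt n \<le> \<bar>y j\<bar>" "\<bar>y j\<bar> \<le> sqrt (2 / \<delta>) / sqrt n"
          using j by (auto simp: B_def T_def)
        have z: "\<bar>\<epsilon> / sqrt n * k \<epsilon> j\<bar> \<le> \<bar>y j\<bar>" "\<bar>y j - \<epsilon> / sqrt n * k \<epsilon> j\<bar> \<le> \<epsilon> / sqrt n"
          using round_to_grid(1,2)[OF h[OF \<epsilon>(1)] y(1), of y] \<epsilon>(1)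
          by (simp_all add: k_def abs_mult)
        have "\<rho> / (2 * sqrt n) = \<rho> / sqrt n - \<rho> / 2 / sqrt n" using n by (simp add: field_simps)
        moreover have "\<epsilon> / sqrt n \<le> \<rho> / 2 / sqrt n" using \<epsilon>(2) by (intro divide_right_mono) auto
        ultimately show ?thesis using y z by linarith
      qed
      ultimately show ?thesis
        using grid supp[OF \<epsilon>(1)] unfolding spread_grid_def by blast
    qed
    thus False using near[OF \<epsilon>(1) spread] by simp
  qed
qed

end

context typical_graph
begin

lemma degree_pos: "i < n \<Longrightarrow> 0 < degree_of n E i"
  using deg[of i] n p by (metis divide_pos_pos gr0I mult_pos_pos not_le of_nat_0 of_nat_0_less_iff zero_less_numeral)

text \<open>Transfers lower bounds from the normalized vector \<open>y\<close> back to
  \<open>v\<close>: the degrees are at least of order n, while the norm \<open>s\<close> of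
  \<open>D\<^sup>-\<^sup>1\<^sup>/\<^sup>2 v\<close> is at least 1 / sqrt n.\<close>

lemma coordinate_lower_bound:
  assumes "i < n" and "\<epsilon> / sqrt n \<le> \<bar>y\<bar>" and "1 / n \<le> s\<^sup>2" and "0 < s"
  shows "sqrt (p / 2) * \<epsilon> / sqrt n \<le> \<bar>sqrt (degree_of n E i) * (s * y)\<bar>"
proof -
  have "1 / sqrt n \<le> s"
    using real_sqrt_le_mono[OF assms(3)] assms(4) by (simp add: real_sqrt_divide)
  moreover have "sqrt (n * p / 2) \<le> sqrt (degree_of n E i)"
    using deg[OF assms(1)] by (rule real_sqrt_le_mono)
  ultimately have "sqrt (n * p / 2) * (1 / sqrt n) \<le> sqrt (degree_of n E i) * s"
    using p assms(4) by (intro mult_mono) auto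
  moreover have "sqrt (n * p / 2) * (1 / sqrt n) = sqrt (p / 2)"
    using n p by (simp add: real_sqrt_mult real_sqrt_divide)
  ultimately have le: "sqrt (p / 2) \<le> sqrt (degree_of n E i) * s" by simp
  have "sqrt (p / 2) * (\<epsilon> / sqrt n) \<le> sqrt (p / 2) * \<bar>y\<bar>"
    using p assms(2) by (intro mult_left_mono) auto
  also have "\<dots> \<le> sqrt (degree_of n E i) * s * \<bar>y\<bar>"
    by (intro mult_right_mono le) auto
  finally show ?thesis using assms(4) by (simp add: abs_mult mult.assoc)
qed

text \<open>Subtracting the degree-weighted mean gives a vector orthogonal to the degrees that
  solves the equation with \<mu> = 1. For large \<open>n\<close> this contradicts
  \<open>eigenvalue_bound\<close> unless the vector is 0.\<close>

lemma kernel_constant: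
  fixes x :: "nat \<Rightarrow> real"
  assumes large: "11 * sqrt n + 121 / p < n * p / 2"
    and eig: "\<And>i. i < n \<Longrightarrow> (\<Sum>j<n. adj E i j * x j) = degree_of n E i * x i"
  obtains c where "\<And>i. i < n \<Longrightarrow> x i = c"
proof -
  define m where "m = (\<Sum>i<n. real (degree_of n E i))"
  have "0 < m" unfolding m_def using n degree_pos by (intro sum_pos) auto
  define c where "c = (\<Sum>i<n. degree_of n E i * x i) / m"
  define y where "y i = x i - c" for i
  have orth: "(\<Sum>i<n. degree_of n E i * y i) = 0"
  proof -
    have "(\<Sum>i<n. degree_of n E i * y i) = (\<Sum>i<n. degree_of n E i * x i) - m * c"
      by (simp add: y_def right_diff_distrib sum_subtractf m_def sum_distrib_right)
    thus ?thesis using \<open>0 < m\<close> by (simp add: c_def)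
  qed
  have "(\<Sum>j<n. adj E i j * y j) = (1::real) * degree_of n E i * y i" if "i < n" for i
  proof -
    have "(\<Sum>j<n. adj E i j * y j) = (\<Sum>j<n. adj E i j * x j) - (\<Sum>j<n. adj E i j) * c"
      by (simp only: y_def right_diff_distrib sum_subtractf sum_distrib_right)
    thus ?thesis unfolding eig[OF that] degree_of_eq_sum[symmetric] by (simp add: y_def algebra_simps)
  qed
  from eigenvalue_bound[OF orth this]
  have "n * p / 2 * (\<Sum>i<n. (y i)\<^sup>2) \<le> (11 * sqrt n + 121 / p) * (\<Sum>i<n. (y i)\<^sup>2)" by simp
  hence "(\<Sum>i<n. (y i)\<^sup>2) \<le> 0"
    using mult_strict_right_mono[OF large, of "\<Sum>i<n. (y i)\<^sup>2"] by (meson not_le)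
  hence "(\<Sum>i<n. (y i)\<^sup>2) = 0" by (intro antisym sum_nonneg) auto
  hence "\<And>i. i < n \<Longrightarrow> x i = c" by (simp add: sum_nonneg_eq_0_iff y_def)
  thus ?thesis using that by blast
qed

text \<open>For \<nu> = 0 the vector \<open>y\<close> is constant and every coordinate has absolute
  value 1 / sqrt n. For other \<nu> it is orthogonal to the degrees and
  \<open>card_large_coordinates\<close> applies.\<close>

lemma eigenvector_coordinates:
  assumes ev: "eigenvector (normalized_laplacian n E) v \<nu>" and unit: "L2_set (vec_index v) {..<dim_vec v} = 1"
    and large: "11 * sqrt n + 121 / p < n * p / 2" and \<eta>: "0 < \<eta>"
    and \<rho>: "0 < \<rho>" "\<rho> \<le> 1 / 2" and \<delta>: "0 < \<delta>" and \<epsilon>: "0 < \<epsilon>" "\<epsilon> \<le> \<rho> / 2"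
    and sparse: "\<not> bad_grid n p 11 (3 * ((eig_const p)\<^sup>2 + 122)) \<rho> (sparse_grid n \<delta> \<rho>) E"
    and spread: "\<not> bad_grid n p 11 (3 * ((eig_const p)\<^sup>2 + 122)) \<epsilon> (spread_grid n \<eta> \<delta> \<rho> \<epsilon>) E"
  shows "(1 / 2 - \<eta>) * n \<le> card {i \<in> {..<n}. sqrt (p / 2) * \<epsilon> / sqrt n \<le> \<bar>v $ i\<bar>}"
proof -
  define d where "d i = real (degree_of n E i)" for i
  have d: "0 < d i" if "i < n" for i using degree_pos[OF that] by (simp add: d_def)
  define x where "x i = v $ i / sqrt (d i)" for i
  have vx: "v $ i = sqrt (d i) * x i" if "i < n" for i using d[OF that] by (simp add: x_def)
  have dim: "dim_vec v = n"
    using ev by (auto simp: eigenvector_def normalized_laplacian_def inv_sqrt_degree_mat_def mat_diag_def)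
  have sum_v: "(\<Sum>i<n. (v $ i)\<^sup>2) = 1" using unit by (simp add: L2_set_def dim)
  have eig: "(\<Sum>j<n. adj E i j * x j) = (1 - \<nu>) * degree_of n E i * x i" if "i < n" for i
    using normalized_laplacian_eigenvector[OF ev degree_pos that] by (simp only: x_def d_def)
  define s where "s = sqrt (\<Sum>i<n. (x i)\<^sup>2)"
  have s_sq: "s\<^sup>2 = (\<Sum>i<n. (x i)\<^sup>2)" by (simp add: s_def sum_nonneg)
  have s_ge: "1 / n \<le> s\<^sup>2"
  proof -
    have "1 / n = (\<Sum>i<n. (v $ i)\<^sup>2 / n)" by (simp add: sum_v flip: sum_divide_distrib)
    also have "\<dots> \<le> (\<Sum>i<n. (v $ i)\<^sup>2 / d i)"
      using d degree_of_le by (intro sum_mono divide_left_mono) (auto simp: d_def n)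
    also have "\<dots> = s\<^sup>2" unfolding s_sq
    proof (intro sum.cong refl)
      fix i assume "i \<in> {..<n}"
      thus "(v $ i)\<^sup>2 / d i = (x i)\<^sup>2" using d[of i] by (simp add: x_def power_divide)
    qed
    finally show ?thesis .
  qed
  have s: "0 < s"
  proof -
    have "0 < s\<^sup>2" using s_ge n by (metis less_le_trans of_nat_0_less_iff zero_less_divide_1_iff)
    moreover have "0 \<le> s" by (simp add: s_def sum_nonneg)
    ultimately show ?thesis by (metis less_eq_real_def power_zero_numeral less_irrefl)
  qed
  define y where "y i = x i / s" for i
  have vy: "v $ i = sqrt (degree_of n E i) * (s * y i)" if "i < n" for i
    using vx[OF that] s by (simp add: y_def d_def)
  have unit_y: "(\<Sum>i<n. (y i)\<^sup>2) = 1"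
  proof -
    have "(\<Sum>i<n. (y i)\<^sup>2) = (\<Sum>i<n. (x i)\<^sup>2) / s\<^sup>2"
      by (simp add: y_def power_divide sum_divide_distrib)
    thus ?thesis using s by (simp flip: s_sq)
  qed
  have "(1 / 2 - \<eta>) * n \<le> card {i \<in> {..<n}. \<epsilon> / sqrt n \<le> \<bar>y i\<bar>}"
  proof (cases "\<nu> = 0")
    case True
    obtain c where c: "\<And>i. i < n \<Longrightarrow> x i = c"
      using kernel_constant[OF large, of x] eig True by auto
    have "s\<^sup>2 = n * c\<^sup>2" unfolding s_sq using c by simp
    have "(y i)\<^sup>2 = 1 / n" if "i < n" for i
    proof -
      have "c \<noteq> 0" using \<open>s\<^sup>2 = n * c\<^sup>2\<close> s by auto
      thus ?thesis using c[OF that] \<open>s\<^sup>2 = n * c\<^sup>2\<close> by (simp add: y_def power_divide)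
    qed
    hence y: "\<bar>y i\<bar> = 1 / sqrt n" if "i < n" for i
      using that by (metis real_sqrt_abs real_sqrt_divide real_sqrt_one)
    have "{i \<in> {..<n}. \<epsilon> / sqrt n \<le> \<bar>y i\<bar>} = {..<n}"
      using y \<epsilon> \<rho> n by (auto intro!: divide_right_mono)
    moreover have "(1 / 2 - \<eta>) * n \<le> (1::real) * n" using \<eta> by (intro mult_right_mono) auto
    ultimately show ?thesis by simp
  next
    case False
    \<comment> \<open>Summing the eigenvalue equation over all rows reproduces the weighted sum with
      factor 1 - \<nu>, so it vanishes.\<close>
    have "(\<Sum>i<n. degree_of n E i * x i) = (\<Sum>i<n. \<Sum>j<n. adj E i j * x j)"
      by (rule sum_degree_of_mult)
    also have "\<dots> = (\<Sum>i<n. (1 - \<nu>) * degree_of n E i * x i)"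
      by (intro sum.cong refl eig) simp
    also have "\<dots> = (1 - \<nu>) * (\<Sum>i<n. degree_of n E i * x i)"
      by (simp only: sum_distrib_left mult.assoc)
    finally have "(\<Sum>i<n. degree_of n E i * x i) = (1 - \<nu>) * (\<Sum>i<n. degree_of n E i * x i)" .
    hence orth: "(\<Sum>i<n. degree_of n E i * x i) = 0" using False by (simp add: left_diff_distrib)
    show ?thesis
    proof (rule card_large_coordinates[OF _ _ unit_y \<rho> \<delta> \<epsilon> sparse spread])
      have "(\<Sum>i<n. degree_of n E i * y i) = (\<Sum>i<n. degree_of n E i * x i) / s"
        by (simp add: y_def sum_divide_distrib)
      thus "(\<Sum>i<n. degree_of n E i * y i) = 0" using orth by simp
      show "(\<Sum>j<n. adj E i j * y j) = (1 - \<nu>) * degree_of n E i * y i" if "i < n" for i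
      proof -
        have "(\<Sum>j<n. adj E i j * y j) = (\<Sum>j<n. adj E i j * x j) / s"
          by (simp only: y_def sum_divide_distrib times_divide_eq_right)
        thus ?thesis unfolding eig[OF that] by (simp add: y_def)
      qed
    qed
  qed
  also have "card {i \<in> {..<n}. \<epsilon> / sqrt n \<le> \<bar>y i\<bar>}
      \<le> card {i \<in> {..<n}. sqrt (p / 2) * \<epsilon> / sqrt n \<le> \<bar>v $ i\<bar>}"
    using coordinate_lower_bound[OF _ _ s_ge s] by (intro card_mono) (auto simp: vy)
  finally show ?thesis by simp
qed

end

section \<open>Convergence of the probability to 1\<close>

theorem theorem2:
  fixes p \<eta> :: real
  assumes "0 < p" and "p < 1" and "0 < \<eta>" and "\<eta> < 1 / 2"
  shows "\<exists>C::real.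
    (\<lambda>n. measure_pmf.prob (random_graph n p)
      {E. \<forall>v. unit_second_eigenvector (normalized_laplacian n E) v \<longrightarrow>
            1 / real n *
              real (card {i \<in> {..<n}. \<bar>vec_index v i\<bar> \<ge> 1 / (sqrt (real n) * ln (real n) powr C)})
            \<ge> 1 / 2 - \<eta>})
    \<longlonglongrightarrow> 1"
proof (rule exI[of _ 1])
  \<comment> \<open>The tolerance from \<open>near_constant_round\<close>; the bound 11 on the
    additive constant comes from there as well.\<close>
  define L where "L = 3 * ((eig_const p)\<^sup>2 + 122)"
  have M: "0 \<le> (11::real)" by simp
  have L: "0 \<le> L" by (simp add: L_def)
  obtain \<rho> \<delta> \<kappa> D\<^sub>1 where \<rho>: "0 < \<rho>" "\<rho> \<le> 1 / 2" and \<delta>: "0 < \<delta>" and \<kappa>: "0 < \<kappa>" and sparse: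
    "\<And>n. measure_pmf.prob (coin_flips (vertex_pairs n) p)
       {\<omega>. bad_grid n p 11 L \<rho> (sparse_grid n \<delta> \<rho>) (edges_of n \<omega>)} \<le> D\<^sub>1 * exp (- \<kappa>) ^ n"
    by (rule prob_bad_sparse_grid[OF assms(1,2) M L]) blast
  obtain \<epsilon> D\<^sub>2 N where \<epsilon>: "0 < \<epsilon>" "\<epsilon> \<le> \<rho> / 2" and spread:
    "\<And>n. N \<le> n \<Longrightarrow> measure_pmf.prob (coin_flips (vertex_pairs n) p)
       {\<omega>. bad_grid n p 11 L \<epsilon> (spread_grid n \<eta> \<delta> \<rho> \<epsilon>) (edges_of n \<omega>)} \<le> D\<^sub>2 * (1 / 2) ^ n"
    by (rule prob_bad_spread_grid[OF assms(1,2) M L assms(3,4) \<rho>(1) \<delta>]) blast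
  define S where "S n = {E. \<forall>v. unit_second_eigenvector (normalized_laplacian n E) v \<longrightarrow>
            1 / 2 - \<eta> \<le> 1 / real n *
              real (card {i \<in> {..<n}. 1 / (sqrt (real n) * ln (real n) powr 1) \<le> \<bar>v $ i\<bar>})}" for n
  define err where "err n = 2 * (3 / 32) ^ n + 2 * (real n * exp (- (p\<^sup>2 / 8)) ^ n)
      + D\<^sub>1 * exp (- \<kappa>) ^ n + D\<^sub>2 * (1 / 2) ^ n" for n
  have "eventually (\<lambda>n. 11 * sqrt (real n) + 121 / p < real n * p / 2) sequentially"
    using assms(1) by real_asymp
  \<comment> \<open>The exponent 1 suffices: once log n exceeds the reciprocal of the constant
    \<open>sqrt (p / 2) * \<epsilon>\<close>, the required threshold lies below
    \<open>sqrt (p / 2) * \<epsilon> / sqrt n\<close>.\<close>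
  moreover have "eventually (\<lambda>n. 1 / (sqrt (p / 2) * \<epsilon>) \<le> ln (real n)) sequentially"
    by real_asymp
  ultimately have ev: "eventually (\<lambda>n. 1 - err n \<le> measure_pmf.prob (random_graph n p) (S n)) sequentially"
    using eventually_ge_at_top[of N] eventually_ge_at_top[of "4::nat"]
  proof eventually_elim
    case (elim n)
    let ?Q = "coin_flips (vertex_pairs n) p"
    let ?B\<^sub>1 = "{\<omega>. \<not> quad_bounded n p (edges_of n \<omega>)}"
    let ?B\<^sub>2 = "{\<omega>. \<exists>i<n. real (degree_of n (edges_of n \<omega>) i) < real n * p / 2}"
    let ?B\<^sub>3 = "{\<omega>. bad_grid n p 11 L \<rho> (sparse_grid n \<delta> \<rho>) (edges_of n \<omega>)}"
    let ?B\<^sub>4 = "{\<omega>. bad_grid n p 11 L \<epsilon> (spread_grid n \<eta> \<delta> \<rho> \<epsilon>) (edges_of n \<omega>)}"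
    have n: "0 < n" using elim by simp
    have thr: "1 / (sqrt n * ln n powr 1) \<le> sqrt (p / 2) * \<epsilon> / sqrt n"
    proof -
      have pos: "0 < sqrt (p / 2) * \<epsilon>" using assms(1) \<epsilon> by simp
      have "0 < ln n" using elim(2) pos by (smt (verit) divide_pos_pos)
      moreover have "1 \<le> sqrt (p / 2) * \<epsilon> * ln n"
        using elim(2) pos by (simp add: pos_divide_le_eq mult.commute)
      ultimately show ?thesis using n by (simp add: field_simps)
    qed
    \<comment> \<open>Outside these four events the graph is typical and has no bad grid vector, so
      the deterministic result covers all \<open>v\<close> at once.\<close>
    have "- (edges_of n -` S n) \<subseteq> ?B\<^sub>1 \<union> (?B\<^sub>2 \<union> (?B\<^sub>3 \<union> ?B\<^sub>4))"
    proof (rule ccontr)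
      assume "\<not> ?thesis"
      then obtain \<omega> where "\<omega> \<in> - (edges_of n -` S n)" "\<omega> \<notin> ?B\<^sub>1 \<union> (?B\<^sub>2 \<union> (?B\<^sub>3 \<union> ?B\<^sub>4))"
        by blast
      hence \<omega>: "edges_of n \<omega> \<notin> S n" "quad_bounded n p (edges_of n \<omega>)"
        "\<not> (\<exists>i<n. real (degree_of n (edges_of n \<omega>) i) < real n * p / 2)"
        "\<not> bad_grid n p 11 L \<rho> (sparse_grid n \<delta> \<rho>) (edges_of n \<omega>)"
        "\<not> bad_grid n p 11 L \<epsilon> (spread_grid n \<eta> \<delta> \<rho> \<epsilon>) (edges_of n \<omega>)"
        by simp_all
      interpret typical_graph n p "edges_of n \<omega>"
      proof unfold_locales
        show "real n * p / 2 \<le> real (degree_of n (edges_of n \<omega>) i)" if "i < n" for i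
          using \<omega>(3) that by (meson not_le)
      qed (use \<omega>(2) assms(1,2) n in auto)
      have "edges_of n \<omega> \<in> S n"
        unfolding S_def
      proof (intro CollectI allI impI)
        fix v assume v: "unit_second_eigenvector (normalized_laplacian n (edges_of n \<omega>)) v"
        have "(1 / 2 - \<eta>) * n \<le> card {i \<in> {..<n}. sqrt (p / 2) * \<epsilon> / sqrt n \<le> \<bar>v $ i\<bar>}"
          using v \<omega>(4,5) elim(1) assms(3) \<rho> \<delta> \<epsilon> unfolding unit_second_eigenvector_def L_def
          by (intro eigenvector_coordinates) auto
        also have "card {i \<in> {..<n}. sqrt (p / 2) * \<epsilon> / sqrt n \<le> \<bar>v $ i\<bar>}
          \<le> card {i \<in> {..<n}. 1 / (sqrt (real n) * ln (real n) powr 1) \<le> \<bar>v $ i\<bar>}"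
          using order_trans[OF thr] by (intro card_mono) auto
        finally have "(1 / 2 - \<eta>) * n \<le>
          card {i \<in> {..<n}. 1 / (sqrt (real n) * ln (real n) powr 1) \<le> \<bar>v $ i\<bar>}" by simp
        thus "1 / 2 - \<eta> \<le> 1 / real n *
            real (card {i \<in> {..<n}. 1 / (sqrt (real n) * ln (real n) powr 1) \<le> \<bar>v $ i\<bar>})"
          using n by (simp add: pos_le_divide_eq)
      qed
      with \<omega>(1) show False by simp
    qed
    hence "measure_pmf.prob ?Q (- (edges_of n -` S n)) \<le> measure_pmf.prob ?Q (?B\<^sub>1 \<union> (?B\<^sub>2 \<union> (?B\<^sub>3 \<union> ?B\<^sub>4)))"
      by (intro measure_pmf.finite_measure_mono) auto
    also have "\<dots> \<le> measure_pmf.prob ?Q ?B\<^sub>1 + (measure_pmf.prob ?Q ?B\<^sub>2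
        + (measure_pmf.prob ?Q ?B\<^sub>3 + measure_pmf.prob ?Q ?B\<^sub>4))"
      by (intro order_trans[OF measure_Un_le] add_left_mono) auto
    also have "\<dots> \<le> 2 * (3 / 32) ^ n + (real n * (2 * exp (- (p\<^sup>2 / 8)) ^ n)
        + (D\<^sub>1 * exp (- \<kappa>) ^ n + D\<^sub>2 * (1 / 2) ^ n))"
      using assms elim n
      by (intro add_mono prob_not_quad_bounded prob_low_degree sparse spread) auto
    also have "\<dots> = err n" by (simp add: err_def)
    finally have "measure_pmf.prob ?Q (- (edges_of n -` S n)) \<le> err n" .
    moreover have "measure_pmf.prob ?Q (- (edges_of n -` S n)) = 1 - measure_pmf.prob ?Q (edges_of n -` S n)"
      using measure_pmf.prob_compl[of "edges_of n -` S n" ?Q] by (simp add: Compl_eq_Diff_UNIV)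
    moreover have "random_graph n p = map_pmf (edges_of n) ?Q"
      by (simp add: random_graph_def edges_of_def[abs_def])
    ultimately show ?case by simp
  qed
  have "(\<lambda>n. 1 - err n) \<longlonglongrightarrow> 1 - (2 * 0 + 2 * 0 + D\<^sub>1 * 0 + D\<^sub>2 * 0)"
    unfolding err_def
    by (intro tendsto_intros LIMSEQ_power_zero powser_times_n_limit_0) (use \<kappa> assms in auto)
  hence lim: "(\<lambda>n. 1 - err n) \<longlonglongrightarrow> 1" by simp
  have "(\<lambda>n. measure_pmf.prob (random_graph n p) (S n)) \<longlonglongrightarrow> 1"
    by (rule tendsto_sandwich[OF ev _ lim tendsto_const]) auto
  thus "(\<lambda>n. measure_pmf.prob (random_graph n p)
      {E. \<forall>v. unit_second_eigenvector (normalized_laplacian n E) v \<longrightarrow>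
            1 / real n *
              real (card {i \<in> {..<n}. \<bar>vec_index v i\<bar> \<ge> 1 / (sqrt (real n) * ln (real n) powr 1)})
            \<ge> 1 / 2 - \<eta>}) \<longlonglongrightarrow> 1"
    by (simp add: S_def)
qed

end
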